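(* Let $k$ be any field, let $\mathbb{P}_k(a_0,\ldots,a_{n+1})$ be a well-formed weighted projective space, and let $X = \{f = 0\} \subset \mathbb{P}_k(a_0,\ldots,a_{n+1})$ be an irreducible hypersurface, where $f$ is an invertible Delsarte polynomial that is weighted homogeneous with respect to the weights $a_0,\ldots,a_{n+1}$. Let $B$ be the matrix associated to $f$ and let $d$ be the weighted degree of $f$. If $d = |\det(B)|$, then $X$ is rational over $k$.
   Context: For positive integers $a_0,\ldots,a_{n+1}$, the weighted projective space is $\mathbb{P}_k(a_0,\ldots,a_{n+1}) = \mathrm{Proj}(k[x_0,\ldots,x_{n+1}])$, where $x_i$ has weight $a_i$. It is well-formed if $\gcd(a_0,\ldots,\widehat{a_i},\ldots,a_{n+1}) = 1$ for each $i = 0,\ldots,n+1$ (the hat denotes omission). A weighted homogeneous polynomial $f \in k[x_0,\ldots,x_{n+1}]$ is Delsarte if it has the same number of monomials as variables, i.e. $f = \sum_{i=0}^{n+1} K_i \prod_{j=0}^{n+1} x_j^{b_{ij}}$ with nonzero constants $K_i \in k$ and distinct monomials. The matrix associated to $f$ is the $(n+2)\times(n+2)$ matrix $B = (b_{ij})$ of exponents. The Delsarte polynomial $f$ is invertible if $B$ is invertible over $\mathbb{Q}$. An irreducible variety $X$ over $k$ is rational over $k$ if there is a birational map $X \dashrightarrow \mathbb{P}^{\dim X}_k$ defined over $k$. *)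

theory Defs
  imports
    "HOL-Library.Poly_Mapping"
    "HOL-Analysis.Abstract_Topology"
    "HOL-Algebra.Algebraic_Closure_Type"
    "Jordan_Normal_Form.Determinant"
begin

text \<open>
  Varieties over an arbitrary field \<open>k\<close> (the type \<open>'a\<close>) are described by their points over the
  algebraic closure of \<open>k\<close>, together with the Zariski topology given by polynomials with
  coefficients in \<open>k\<close> and the sheaf of functions that are locally fractions of polynomials with
  coefficients in \<open>k\<close>.  Reduced schemes of finite type over \<open>k\<close> and their \<open>k\<close>-morphisms embed
  fully faithfully into spaces with functions of this kind, also when \<open>k\<close> is finite or imperfect.
\<close>

section \<open>Polynomials\<close>

text \<open>The variables are \<open>x\<^sub>0, x\<^sub>1, \<dots>\<close>; an exponent vector is a finitely supported function on
  their indices.\<close>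

type_synonym 'a mvpoly = "(nat \<Rightarrow>\<^sub>0 nat) \<Rightarrow>\<^sub>0 'a"

text \<open>\<open>p\<close> lies in \<open>k[x\<^sub>0, \<dots>, x\<^bsub>N-1\<^esub>]\<close> and is homogeneous of degree \<open>d\<close> when \<open>x\<^sub>i\<close> has weight
  \<open>a i\<close>.  The zero polynomial is homogeneous of every degree.\<close>

definition weighted_homogeneous ::
  "nat \<Rightarrow> (nat \<Rightarrow> nat) \<Rightarrow> nat \<Rightarrow> 'a::zero mvpoly \<Rightarrow> bool" where
  "weighted_homogeneous N a d p \<longleftrightarrow>
     (\<forall>m\<in>Poly_Mapping.keys p.
        Poly_Mapping.keys m \<subseteq> {..<N} \<and>
        (\<Sum>i\<in>Poly_Mapping.keys m. Poly_Mapping.lookup m i * a i) = d)"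

definition eval_mvpoly ::
  "'a::field mvpoly \<Rightarrow> (nat \<Rightarrow> 'a alg_closure) \<Rightarrow> 'a alg_closure" where
  "eval_mvpoly p x =
     (\<Sum>m\<in>Poly_Mapping.keys p.
        to_ac (Poly_Mapping.lookup p m) *
        (\<Prod>i\<in>Poly_Mapping.keys m. x i ^ Poly_Mapping.lookup m i))"

section \<open>Weighted projective spaces\<close>

text \<open>A point of \<open>\<P>(a\<^sub>0, \<dots>, a\<^bsub>N-1\<^esub>)\<close> over the algebraic closure is an orbit of the action of
  the nonzero scalars with weights \<open>a\<close> on nonzero vectors.  Vectors of length \<open>N\<close> are functions
  on \<open>nat\<close> that vanish from \<open>N\<close> on.\<close>

type_synonym 'a wpoint = "(nat \<Rightarrow> 'a alg_closure) set"

definition nonzero_vectors :: "nat \<Rightarrow> (nat \<Rightarrow> 'a::field alg_closure) set" where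
  "nonzero_vectors N = {x. (\<forall>i\<ge>N. x i = 0) \<and> (\<exists>i<N. x i \<noteq> 0)}"

definition weighted_rel ::
  "nat \<Rightarrow> (nat \<Rightarrow> nat) \<Rightarrow> ((nat \<Rightarrow> 'a::field alg_closure) \<times> (nat \<Rightarrow> 'a alg_closure)) set" where
  "weighted_rel N a =
     {(x, y). x \<in> nonzero_vectors N \<and> y \<in> nonzero_vectors N \<and>
        (\<exists>t. t \<noteq> 0 \<and> (\<forall>i. y i = t ^ a i * x i))}"

definition wproj :: "nat \<Rightarrow> (nat \<Rightarrow> nat) \<Rightarrow> 'a::field wpoint set" where
  "wproj N a = nonzero_vectors N // weighted_rel N a"

definition well_formed :: "nat \<Rightarrow> (nat \<Rightarrow> nat) \<Rightarrow> bool" where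
  "well_formed N a \<longleftrightarrow> (\<forall>i<N. 0 < a i) \<and> (\<forall>i<N. Gcd (a ` ({..<N} - {i})) = 1)"

text \<open>The topology with basis \<open>D\<^sub>+(g)\<close>, for \<open>g\<close> homogeneous with coefficients in \<open>k\<close>.\<close>

definition zariski :: "nat \<Rightarrow> (nat \<Rightarrow> nat) \<Rightarrow> 'a::field wpoint topology" where
  "zariski N a = topology_generated_by
     {D. \<exists>d (g :: 'a mvpoly). weighted_homogeneous N a d g \<and>
         D = {P \<in> wproj N a. \<forall>x\<in>P. eval_mvpoly g x \<noteq> 0}}"

definition hypersurface :: "nat \<Rightarrow> (nat \<Rightarrow> nat) \<Rightarrow> 'a::field mvpoly \<Rightarrow> 'a wpoint set" where
  "hypersurface N a f = {P \<in> wproj N a. \<forall>x\<in>P. eval_mvpoly f x = 0}"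

definition irreducible_space :: "'p topology \<Rightarrow> bool" where
  "irreducible_space T \<longleftrightarrow>
     topspace T \<noteq> {} \<and>
     (\<forall>C D. closedin T C \<and> closedin T D \<and> C \<union> D = topspace T \<longrightarrow>
        C = topspace T \<or> D = topspace T)"

section \<open>Morphisms and birational maps over \<open>k\<close>\<close>

text \<open>\<open>U\<close> is a locally closed subset of \<open>wproj N a\<close>, with its reduced structure.  Values of \<open>s\<close>
  outside \<open>U\<close> are irrelevant.\<close>

definition regular_on ::
  "nat \<Rightarrow> (nat \<Rightarrow> nat) \<Rightarrow> 'a::field wpoint set \<Rightarrow> ('a wpoint \<Rightarrow> 'a alg_closure) \<Rightarrow> bool" where
  "regular_on N a U s \<longleftrightarrow>
     (\<forall>P\<in>U. \<exists>W d (g :: 'a mvpoly) (h :: 'a mvpoly).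
        openin (subtopology (zariski N a) U) W \<and> P \<in> W \<and>
        weighted_homogeneous N a d g \<and> weighted_homogeneous N a d h \<and>
        (\<forall>Q\<in>W. \<forall>x\<in>Q. eval_mvpoly h x \<noteq> 0 \<and> s Q = eval_mvpoly g x / eval_mvpoly h x))"

definition morphism_on ::
  "nat \<Rightarrow> (nat \<Rightarrow> nat) \<Rightarrow> 'a::field wpoint set \<Rightarrow>
   nat \<Rightarrow> (nat \<Rightarrow> nat) \<Rightarrow> 'a wpoint set \<Rightarrow> ('a wpoint \<Rightarrow> 'a wpoint) \<Rightarrow> bool" where
  "morphism_on N a U M b V \<phi> \<longleftrightarrow>
     continuous_map (subtopology (zariski N a) U) (subtopology (zariski M b) V) \<phi> \<and>
     (\<forall>W s. openin (subtopology (zariski M b) V) W \<and> regular_on M b W s \<longrightarrow>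
        regular_on N a {P \<in> U. \<phi> P \<in> W} (s \<circ> \<phi>))"

text \<open>For irreducible \<open>Y\<close> and \<open>Z\<close>, whose nonempty open subsets are dense: a birational map is an
  isomorphism between nonempty open subsets.\<close>

definition birational_map ::
  "nat \<Rightarrow> (nat \<Rightarrow> nat) \<Rightarrow> 'a::field wpoint set \<Rightarrow>
   nat \<Rightarrow> (nat \<Rightarrow> nat) \<Rightarrow> 'a wpoint set \<Rightarrow>
   'a wpoint set \<Rightarrow> 'a wpoint set \<Rightarrow> ('a wpoint \<Rightarrow> 'a wpoint) \<Rightarrow> bool" where
  "birational_map N a Y M b Z U V \<phi> \<longleftrightarrow>
     openin (subtopology (zariski N a) Y) U \<and> U \<noteq> {} \<and>
     openin (subtopology (zariski M b) Z) V \<and> V \<noteq> {} \<and>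
     morphism_on N a U M b V \<phi> \<and>
     (\<exists>\<psi>. morphism_on M b V N a U \<psi> \<and>
        (\<forall>P\<in>U. \<psi> (\<phi> P) = P) \<and> (\<forall>Q\<in>V. \<phi> (\<psi> Q) = Q))"

text \<open>The parameter \<open>n\<close> is the dimension of \<open>Y\<close>; the target is the space \<open>\<P>\<^sup>n\<close> over \<open>k\<close>, with its
  \<open>n + 1\<close> variables of weight 1.\<close>

definition rational_variety ::
  "nat \<Rightarrow> (nat \<Rightarrow> nat) \<Rightarrow> 'a::field wpoint set \<Rightarrow> nat \<Rightarrow> bool" where
  "rational_variety N a Y n \<longleftrightarrow>
     (\<exists>U V \<phi>. birational_map N a Y (n + 1) (\<lambda>_. 1) (wproj (n + 1) (\<lambda>_. 1)) U V \<phi>)"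

section \<open>Delsarte polynomials\<close>

text \<open>\<open>f = \<Sum>\<^sub>i K\<^sub>i \<Prod>\<^sub>j x\<^sub>j\<^bsup>B\<^sub>i\<^sub>j\<^esup>\<close>, a polynomial in \<open>N\<close> variables with associated matrix \<open>B\<close>.  The
  matrix depends on the order of the monomials; invertibility and \<open>|det B|\<close> do not.\<close>

definition delsarte :: "nat \<Rightarrow> nat mat \<Rightarrow> 'a::field mvpoly \<Rightarrow> bool" where
  "delsarte N B f \<longleftrightarrow>
     B \<in> carrier_mat N N \<and> inj_on (row B) {..<N} \<and>
     (\<exists>K :: nat \<Rightarrow> 'a. (\<forall>i<N. K i \<noteq> 0) \<and>
        f = (\<Sum>i<N. Poly_Mapping.single (\<Sum>j<N. Poly_Mapping.single j (B $$ (i, j))) (K i)))"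

definition invertible_delsarte :: "nat \<Rightarrow> nat mat \<Rightarrow> 'a::field mvpoly \<Rightarrow> bool" where
  "invertible_delsarte N B f \<longleftrightarrow>
     delsarte N B f \<and> invertible_mat (map_mat of_nat B :: rat mat)"

end

theory Submission
  imports Defs
begin

text \<open>Write \<open>N = n + 2\<close> and let \<open>b\<^sub>i\<close> be the exponent vectors of \<open>f\<close>, the rows of \<open>B\<close>.  On the part of
  \<open>X\<close> where no coordinate vanishes, the equation says that the monomials \<open>y\<^sub>i = x\<^bsup>b\<^sub>i\<^esup>\<close> satisfy the
  linear relation \<open>\<Sum>\<^sub>i K\<^sub>i y\<^sub>i = 0\<close>, and all \<open>y\<^sub>i\<close> have weighted degree \<open>d\<close>.  So \<open>x \<mapsto> [y\<^sub>0 : \<dots> : y\<^sub>N\<^sub>-\<^sub>1]\<close>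
  maps this torus part of \<open>X\<close> to the torus part of a hyperplane in \<open>\<P>\<^bsup>N-1\<^esup>\<close>, and a hyperplane is a
  \<open>\<P>\<^sup>n\<close>.  The point is that this map is an isomorphism when \<open>\<bar>det B\<bar> = d\<close>.

  The characters of the torus of the weighted projective space are the exponent vectors of weight 0.
  The weight \<open>\<int>\<^sup>N \<rightarrow> \<int>\<close> is onto, because the weights have greatest common divisor 1, and it maps the
  lattice spanned by the \<open>b\<^sub>i\<close>, which has index \<open>\<bar>det B\<bar>\<close>, onto \<open>d \<int>\<close>, which has index \<open>d\<close>.  So if
  \<open>\<bar>det B\<bar> = d\<close>, the differences \<open>b\<^sub>i - b\<^sub>0\<close> generate all vectors of weight 0.  Lemma
  \<open>differences_generate_weight_zero\<close> proves this by completing the differences with a vector \<open>e\<close> of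
  weight 1 to a square matrix and computing that its determinant is \<open>\<plusminus>1\<close>.

  Hence each \<open>x\<^sub>j\<close> is, up to the action of the scalars, a Laurent monomial in the \<open>y\<^sub>i\<close>.  Multiplying
  \<open>x\<^sub>j\<close> by \<open>(y\<^sub>0 \<cdots> y\<^sub>N\<^sub>-\<^sub>1)\<^bsup>r a\<^sub>j\<^esup>\<close> for large \<open>r\<close>, which does not change the point, makes all exponents
  natural numbers (\<open>exponent_inverse\<close>).  The map and its inverse are then both given by forms, and
  such maps are morphisms (\<open>morphism_on_induced_map\<close>); \<open>rational_if_exponents_invertible\<close> checks
  that they are mutually inverse.\<close>

section \<open>Exponent lattices\<close>

lemma bezout_family_int:
  fixes a :: "nat \<Rightarrow> nat"
  shows "\<exists>e. (\<Sum>i<n. e i * int (a i)) = int (Gcd (a ` {..<n}))"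
proof (induction n)
  case 0
  show ?case by simp
next
  case (Suc n)
  then obtain e where e: "(\<Sum>i<n. e i * int (a i)) = int (Gcd (a ` {..<n}))" by blast
  obtain u v where uv: "u * int (a n) + v * int (Gcd (a ` {..<n})) = gcd (int (a n)) (int (Gcd (a ` {..<n})))"
    using bezout_int by blast
  define e' where "e' i = (if i = n then u else v * e i)" for i
  have "(\<Sum>i<n. e' i * int (a i)) = v * (\<Sum>i<n. e i * int (a i))"
    by (simp add: e'_def sum_distrib_left mult.assoc)
  moreover have "e' n = u"
    by (simp add: e'_def)
  ultimately have "(\<Sum>i<Suc n. e' i * int (a i)) = int (gcd (a n) (Gcd (a ` {..<n})))"
    using uv e by (simp add: add.commute)
  moreover have "Gcd (a ` {..<Suc n}) = gcd (a n) (Gcd (a ` {..<n}))"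
    by (simp add: lessThan_Suc)
  ultimately show ?case by metis
qed

lemma adjugate_mult_entries:
  fixes m :: "nat \<Rightarrow> nat \<Rightarrow> 'r::comm_ring_1"
  assumes A: "A = mat N N (\<lambda>(i, j). m i j)" and "k < N" "l < N"
  shows "(\<Sum>i<N. cofactor A i k * m i l) = (if k = l then det A else 0)"
proof -
  have "A \<in> carrier_mat N N"
    by (simp add: A)
  from adj_mat(3)[OF this] have "(adj_mat A * A) $$ (k, l) = (det A \<cdot>\<^sub>m 1\<^sub>m N) $$ (k, l)"
    by simp
  moreover have "(adj_mat A * A) $$ (k, l) = (\<Sum>i<N. cofactor A i k * m i l)"
    using assms by (simp add: adj_mat_def scalar_prod_def atLeast0LessThan)
  ultimately show ?thesis
    using assms(2,3) by (auto split: if_splits)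
qed

lemma adjugate_mult_entries_right:
  fixes m :: "nat \<Rightarrow> nat \<Rightarrow> 'r::comm_ring_1"
  assumes A: "A = mat N N (\<lambda>(i, j). m i j)" and "k < N" "l < N"
  shows "(\<Sum>i<N. m k i * cofactor A l i) = (if k = l then det A else 0)"
proof -
  have "A \<in> carrier_mat N N"
    by (simp add: A)
  from adj_mat(2)[OF this] have "(A * adj_mat A) $$ (k, l) = (det A \<cdot>\<^sub>m 1\<^sub>m N) $$ (k, l)"
    by simp
  moreover have "(A * adj_mat A) $$ (k, l) = (\<Sum>i<N. m k i * cofactor A l i)"
    using assms by (simp add: adj_mat_def scalar_prod_def atLeast0LessThan)
  ultimately show ?thesis
    using assms(2,3) by (auto split: if_splits)
qed

lemma det_subtract_first_row:
  fixes b :: "nat \<Rightarrow> nat \<Rightarrow> 'r::comm_ring_1"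
  assumes "N > 0"
  shows "det (mat N N (\<lambda>(i, j). if i = 0 then b 0 j else b i j - b 0 j))
    = det (mat N N (\<lambda>(i, j). b i j))"
proof -
  let ?B = "mat N N (\<lambda>(i, j). b i j)"
  \<comment> \<open>subtraction of the first row from all others, as left multiplication\<close>
  define E :: "'r mat" where "E = mat N N (\<lambda>(i, j). if i = j then 1 else if j = 0 then - 1 else 0)"
  have E: "E \<in> carrier_mat N N"
    by (simp add: E_def)
  have "det E = prod_list (diag_mat E)"
    by (rule det_lower_triangular[OF _ E]) (simp add: E_def)
  also have "diag_mat E = map (\<lambda>_. 1) [0..<N]"
    by (auto simp: diag_mat_def E_def)
  also have "prod_list \<dots> = (1 :: 'r)"
    by (induction N) auto
  finally have "det E = 1" .
  have row: "(\<Sum>k<N. E $$ (i, k) * b k j) = (if i = 0 then b 0 j else b i j - b 0 j)"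
    if "i < N" for i j
  proof -
    have "(\<Sum>k<N. E $$ (i, k) * b k j)
      = (\<Sum>k<N. (if k = i then b i j else 0) - (if k = 0 then if i = 0 then 0 else b 0 j else 0))"
      using that by (intro sum.cong) (auto simp: E_def)
    also have "\<dots> = (if i = 0 then b 0 j else b i j - b 0 j)"
      using that assms by (simp add: sum_subtractf)
    finally show ?thesis .
  qed
  have "mat N N (\<lambda>(i, j). if i = 0 then b 0 j else b i j - b 0 j) = E * ?B"
  proof (rule eq_matI)
    fix i j assume "i < dim_row (E * ?B)" "j < dim_col (E * ?B)"
    then have ij: "i < N" "j < N" using E by auto
    have "(E * ?B) $$ (i, j) = (\<Sum>k<N. E $$ (i, k) * b k j)"
      using ij E by (simp add: scalar_prod_def atLeast0LessThan)
    then show "mat N N (\<lambda>(i, j). if i = 0 then b 0 j else b i j - b 0 j) $$ (i, j) = (E * ?B) $$ (i, j)"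
      using row ij by simp
  qed (use E in auto)
  then show ?thesis
    using det_mult[OF E, of ?B] \<open>det E = 1\<close> by simp
qed

text \<open>The vectors \<open>\<epsilon>\<^sub>j - a\<^sub>j e\<close>, which span the vectors of weight 0 when \<open>e\<close> has weight 1, are integer
  combinations of the \<open>b\<^sub>i\<close>, with coefficients \<open>c\<^sub>j\<^sub>i\<close>.  (Pairing the identity with \<open>a\<close> shows that
  the coefficients for fixed \<open>j\<close> sum to 0, so these are combinations of differences.)

  Let \<open>M v\<close> be the matrix with rows \<open>v, b\<^sub>1 - b\<^sub>0, b\<^sub>2 - b\<^sub>0, \<dots>\<close> and let \<open>\<kappa>\<close> be the vector of cofactors
  along its first row, which does not depend on \<open>v\<close>.  Row operations give \<open>det (M b\<^sub>0) = det b = \<plusminus>d\<close>,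
  while \<open>M b\<^sub>0\<close> sends \<open>a\<close> to \<open>d\<close> times the first unit vector.  Applying the adjugate gives
  \<open>d \<kappa> = \<plusminus>d a\<close>, so \<open>\<kappa> = \<plusminus>a\<close>, and therefore \<open>det (M e) = e \<cdot> \<kappa> = \<plusminus>1\<close>: the matrix \<open>M e\<close> is
  invertible over the integers.\<close>

lemma differences_generate_weight_zero:
  fixes b :: "nat \<Rightarrow> nat \<Rightarrow> int" and a e :: "nat \<Rightarrow> int"
  assumes "N > 0"
    and weight: "\<And>i. i < N \<Longrightarrow> (\<Sum>j<N. b i j * a j) = d"
    and det: "\<bar>det (mat N N (\<lambda>(i, j). b i j))\<bar> = d" and "d \<noteq> 0"
    and e: "(\<Sum>j<N. e j * a j) = 1"
  obtains c where
    "\<And>j l. j < N \<Longrightarrow> l < N \<Longrightarrow>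
      (\<Sum>i<N. c j i * b i l) = (if j = l then 1 else 0) - a j * e l"
proof -
  define m where "m v i l = (if i = 0 then v l else b i l - b 0 l)" for v :: "nat \<Rightarrow> int" and i l :: nat
  define M where "M v = mat N N (\<lambda>(i, j). m v i j)" for v
  define s where "s = sgn (det (mat N N (\<lambda>(i, j). b i j)))"
  have s: "s * s = 1" "det (mat N N (\<lambda>(i, j). b i j)) = s * d"
    using det \<open>d \<noteq> 0\<close> by (auto simp: s_def sgn_if abs_if split: if_splits)
  have cof: "cofactor (M v) 0 j = cofactor (M (b 0)) 0 j" for v j
  proof -
    have "mat_delete (M v) 0 j = mat_delete (M (b 0)) 0 j"
      by (rule eq_matI) (auto simp: mat_delete_def M_def m_def)
    then show ?thesis by (simp add: cofactor_def)
  qed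
  have det0: "det (M (b 0)) = s * d"
    using det_subtract_first_row[OF \<open>N > 0\<close>, of b] s by (simp add: M_def m_def)
  have mweight: "(\<Sum>l<N. m (b 0) i l * a l) = (if i = 0 then d else 0)" if "i < N" for i
    using weight[OF that] weight[OF \<open>N > 0\<close>]
    by (auto simp: m_def left_diff_distrib sum_subtractf)
  \<comment> \<open>Both evaluations of \<open>adj (M b\<^sub>0) (M b\<^sub>0) a\<close> are compared in coordinate \<open>k\<close>.\<close>
  have kappa: "cofactor (M (b 0)) 0 k = s * a k" if "k < N" for k
  proof -
    have "(\<Sum>l<N. (\<Sum>i<N. cofactor (M (b 0)) i k * m (b 0) i l) * a l)
        = (\<Sum>l<N. if l = k then s * d * a k else 0)"
      using adjugate_mult_entries[OF M_def that] det0 by (intro sum.cong) auto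
    also have "\<dots> = s * d * a k" using that by simp
    finally have 1: "(\<Sum>l<N. (\<Sum>i<N. cofactor (M (b 0)) i k * m (b 0) i l) * a l) = s * d * a k" .
    have "(\<Sum>l<N. (\<Sum>i<N. cofactor (M (b 0)) i k * m (b 0) i l) * a l)
       = (\<Sum>i<N. cofactor (M (b 0)) i k * (\<Sum>l<N. m (b 0) i l * a l))"
      unfolding sum_distrib_right sum_distrib_left
      by (subst sum.swap) (simp add: mult.assoc)
    also have "\<dots> = (\<Sum>i<N. if i = 0 then cofactor (M (b 0)) 0 k * d else 0)"
      using mweight by (intro sum.cong) auto
    also have "\<dots> = cofactor (M (b 0)) 0 k * d" using \<open>N > 0\<close> by simp
    finally show ?thesis using 1 \<open>d \<noteq> 0\<close> by simp
  qed
  have "det (M e) = (\<Sum>j<N. e j * (s * a j))"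
  proof -
    have "det (M e) = (\<Sum>j<N. M e $$ (0, j) * cofactor (M e) 0 j)"
      by (rule laplace_expansion_row) (use \<open>N > 0\<close> in \<open>auto simp: M_def\<close>)
    also have "\<dots> = (\<Sum>j<N. e j * (s * a j))"
      using \<open>N > 0\<close> kappa cof[of e] by (intro sum.cong) (auto simp: M_def m_def)
    finally show ?thesis .
  qed
  also have "\<dots> = s * (\<Sum>j<N. e j * a j)"
    by (simp add: sum_distrib_left mult.left_commute)
  finally have dete: "det (M e) = s" using e by simp
  \<comment> \<open>the inverse of \<open>M e\<close>; its first column is \<open>a\<close>\<close>
  define G where "G k i = s * cofactor (M e) i k" for k i
  have G0: "G k 0 = a k" if "k < N" for k
    using kappa[OF that] cof[of e k] s by (simp add: G_def flip: mult.assoc)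
  have G: "(\<Sum>i<N. G k i * m e i l) = (if k = l then 1 else 0)" if "k < N" "l < N" for k l
  proof -
    have "(\<Sum>i<N. G k i * m e i l) = s * (\<Sum>i<N. cofactor (M e) i k * m e i l)"
      by (simp add: G_def sum_distrib_left mult.assoc)
    then show ?thesis
      using adjugate_mult_entries[OF M_def that, of e] s dete by simp
  qed
  obtain N' where N': "N = Suc N'" using \<open>N > 0\<close> by (cases N) auto
  \<comment> \<open>expands the combination of differences \<open>b\<^sub>i - b\<^sub>0\<close> into one of the \<open>b\<^sub>i\<close>\<close>
  define c where "c k i = (if i = 0 then - (\<Sum>i<N'. G k (Suc i)) else G k i)" for k i
  show thesis
  proof (rule that)
    fix j l assume jl: "j < N" "l < N"
    have "(\<Sum>i<N. c j i * b i l) = (\<Sum>i<N'. G j (Suc i) * (b (Suc i) l - b 0 l))"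
      unfolding N' sum.lessThan_Suc_shift
      by (simp add: c_def right_diff_distrib sum_subtractf sum_distrib_right)
    moreover have "(\<Sum>i<N. G j i * m e i l) = G j 0 * e l + (\<Sum>i<N'. G j (Suc i) * (b (Suc i) l - b 0 l))"
      unfolding N' sum.lessThan_Suc_shift by (simp add: m_def)
    ultimately show "(\<Sum>i<N. c j i * b i l) = (if j = l then 1 else 0) - a j * e l"
      using G[OF jl] G0[OF jl(1)] by simp
  qed
qed

lemma left_kernel_trivial:
  fixes m :: "nat \<Rightarrow> nat \<Rightarrow> 'r::idom"
  assumes det: "det (mat N N (\<lambda>(i, j). m i j)) \<noteq> 0"
    and zero: "\<And>l. l < N \<Longrightarrow> (\<Sum>i<N. v i * m i l) = 0"
    and "k < N"
  shows "v k = 0"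
proof -
  define A where "A = mat N N (\<lambda>(i, j). m i j)"
  have "0 = (\<Sum>l<N. (\<Sum>i<N. v i * m i l) * cofactor A k l)"
    using zero by simp
  also have "\<dots> = (\<Sum>i<N. v i * (\<Sum>l<N. m i l * cofactor A k l))"
    unfolding sum_distrib_right sum_distrib_left by (subst sum.swap) (simp add: mult.assoc)
  also have "\<dots> = (\<Sum>i<N. if i = k then v k * det A else 0)"
    using adjugate_mult_entries_right[OF A_def _ \<open>k < N\<close>] by (intro sum.cong) auto
  also have "\<dots> = v k * det A"
    using \<open>k < N\<close> by simp
  finally show ?thesis
    using det by (simp add: A_def)
qed

text \<open>Adding \<open>K a\<^sub>j\<close> to every entry of row \<open>j\<close> of the integer matrix \<open>c\<close> from
  \<open>differences_generate_weight_zero\<close> changes \<open>c b\<close> only by a matrix of the form \<open>a \<cdot> s\<^sup>T\<close>, so it keeps the required shape; as all \<open>a\<^sub>j\<close> are positive, a large \<open>K\<close>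
  makes the entries of \<open>c\<close> nonnegative.  It makes \<open>t\<close> nonnegative too, because no column of \<open>b\<close>
  is zero.\<close>

lemma exponent_inverse:
  fixes b :: "nat \<Rightarrow> nat \<Rightarrow> nat" and a :: "nat \<Rightarrow> nat"
  assumes "N > 0"
    and pos: "\<And>j. j < N \<Longrightarrow> a j > 0" and gcd: "Gcd (a ` {..<N}) = 1"
    and weight: "\<And>i. i < N \<Longrightarrow> (\<Sum>j<N. b i j * a j) = d"
    and det: "\<bar>det (mat N N (\<lambda>(i, j). int (b i j)))\<bar> = int d" and "d > 0"
  obtains E t where
    "\<And>j l. j < N \<Longrightarrow> l < N \<Longrightarrow>
      (\<Sum>i<N. E j i * b i l) = (if j = l then 1 else 0) + a j * t l"
proof -
  obtain e where e: "(\<Sum>j<N. e j * int (a j)) = 1"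
    using bezout_family_int[of a N] gcd by auto
  have "(\<Sum>j<N. int (b i j) * int (a j)) = int d" if "i < N" for i
    using weight[OF that] by (metis (mono_tags, lifting) of_nat_mult of_nat_sum sum.cong)
  from differences_generate_weight_zero[OF \<open>N > 0\<close> this det _ e] \<open>d > 0\<close>
  obtain c where c: "(\<Sum>i<N. c j i * int (b i l)) = (if j = l then 1 else 0) - int (a j) * e l"
    if "j < N" "l < N" for j l
    by auto
  \<comment> \<open>any common bound on the \<open>\<bar>c\<^sub>j\<^sub>i\<bar>\<close> and \<open>\<bar>e\<^sub>l\<bar>\<close>\<close>
  define K where "K = (\<Sum>j<N. \<Sum>i<N. \<bar>c j i\<bar>) + (\<Sum>l<N. \<bar>e l\<bar>)"
  have "K \<ge> 0"
    unfolding K_def by (intro add_nonneg_nonneg sum_nonneg) auto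
  have Kc: "\<bar>c j i\<bar> \<le> K" if "j < N" "i < N" for j i
  proof -
    have "\<bar>c j i\<bar> \<le> (\<Sum>i<N. \<bar>c j i\<bar>)"
      using that by (intro member_le_sum) auto
    also have "\<dots> \<le> (\<Sum>j<N. \<Sum>i<N. \<bar>c j i\<bar>)"
      using that by (intro member_le_sum[where f = "\<lambda>j. \<Sum>i<N. \<bar>c j i\<bar>"]) (auto intro: sum_nonneg)
    also have "\<dots> \<le> K"
      by (simp add: K_def sum_nonneg)
    finally show ?thesis .
  qed
  have Ke: "\<bar>e l\<bar> \<le> K" if "l < N" for l
  proof -
    have "\<bar>e l\<bar> \<le> (\<Sum>l<N. \<bar>e l\<bar>)"
      using that by (intro member_le_sum) auto
    also have "\<dots> \<le> K"
      by (simp add: K_def sum_nonneg)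
    finally show ?thesis .
  qed
  have column: "(\<Sum>i<N. b i l) \<ge> 1" if "l < N" for l
  proof (rule ccontr)
    assume "\<not> ?thesis"
    then have "b i l = 0" if "i < N" for i
      using that by (auto simp: not_le)
    then have "det (mat N N (\<lambda>(i, j). int (b i j))) = 0"
      by (subst laplace_expansion_column[of _ N l]) (use \<open>l < N\<close> in auto)
    then show False
      using det \<open>d > 0\<close> by simp
  qed
  have E: "K * int (a j) + c j i \<ge> 0" if "j < N" "i < N" for i j
  proof -
    have "K * 1 \<le> K * int (a j)"
      using pos[OF that(1)] \<open>K \<ge> 0\<close> by (intro mult_left_mono) auto
    then show ?thesis using Kc[OF that] by linarith
  qed
  have t: "K * (\<Sum>i<N. int (b i l)) - e l \<ge> 0" if "l < N" for l
  proof -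
    have "1 \<le> int (\<Sum>i<N. b i l)"
      using column[OF that] by (simp del: of_nat_sum)
    from mult_left_mono[OF this \<open>K \<ge> 0\<close>] show ?thesis using Ke[OF that] by simp
  qed
  show thesis
  proof (rule that[of "\<lambda>j i. nat (K * int (a j) + c j i)" "\<lambda>l. nat (K * (\<Sum>i<N. int (b i l)) - e l)"])
    fix j l assume jl: "j < N" "l < N"
    have "int (\<Sum>i<N. nat (K * int (a j) + c j i) * b i l)
      = (\<Sum>i<N. (K * int (a j) + c j i) * int (b i l))"
      using E jl by simp
    also have "\<dots> = K * int (a j) * (\<Sum>i<N. int (b i l)) + (\<Sum>i<N. c j i * int (b i l))"
      by (simp add: distrib_right sum.distrib sum_distrib_left)
    also have "\<dots> = (if j = l then 1 else 0) + int (a j) * (K * (\<Sum>i<N. int (b i l)) - e l)"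
      using c[OF jl] by (simp add: algebra_simps)
    also have "\<dots> = int ((if j = l then 1 else 0) + a j * nat (K * (\<Sum>i<N. int (b i l)) - e l))"
      using t[OF jl(2)] by simp
    finally show "(\<Sum>i<N. nat (K * int (a j) + c j i) * b i l)
      = (if j = l then 1 else 0) + a j * nat (K * (\<Sum>i<N. int (b i l)) - e l)"
      by (simp only: of_nat_eq_iff)
  qed
qed

text \<open>The monomials with exponent vectors \<open>E\<^sub>j\<close> have degrees proportional to the weights \<open>a\<^sub>j\<close>.  Applying
  both sides of \<open>E b = I + a t\<^sup>T\<close> to \<open>a\<close> shows that \<open>d\<close> times the vector of row sums of \<open>E\<close> is
  \<open>(1 + t \<cdot> a) a\<close>.  As \<open>d\<close> divides the product of the scalar \<open>1 + t \<cdot> a\<close> with every \<open>a\<^sub>j\<close>, and the \<open>a\<^sub>j\<close>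
  have greatest common divisor 1, it divides that scalar.\<close>

lemma exponent_inverse_degree:
  fixes b E :: "nat \<Rightarrow> nat \<Rightarrow> nat" and a t :: "nat \<Rightarrow> nat"
  assumes gcd: "Gcd (a ` {..<N}) = 1" and "d > 0"
    and weight: "\<And>i. i < N \<Longrightarrow> (\<Sum>j<N. b i j * a j) = d"
    and EB: "\<And>j l. j < N \<Longrightarrow> l < N \<Longrightarrow>
      (\<Sum>i<N. E j i * b i l) = (if j = l then 1 else 0) + a j * t l"
  obtains D where "\<And>j. j < N \<Longrightarrow> (\<Sum>i<N. E j i) = D * a j"
proof -
  define c where "c = 1 + (\<Sum>l<N. t l * a l)"
  have dc: "d * (\<Sum>i<N. E j i) = c * a j" if "j < N" for j
  proof -
    have "d * (\<Sum>i<N. E j i) = (\<Sum>i<N. E j i * (\<Sum>l<N. b i l * a l))"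
      using weight by (simp add: sum_distrib_left mult.commute)
    also have "\<dots> = (\<Sum>l<N. (\<Sum>i<N. E j i * b i l) * a l)"
      unfolding sum_distrib_left sum_distrib_right by (subst sum.swap) (simp add: mult.assoc)
    also have "\<dots> = (\<Sum>l<N. (if l = j then a j else 0) + a j * (t l * a l))"
      using EB[OF that] by (intro sum.cong) (auto simp: algebra_simps)
    also have "\<dots> = c * a j"
      using that by (simp add: c_def sum.distrib distrib_left sum_distrib_left mult.commute mult.left_commute)
    finally show ?thesis .
  qed
  have "d dvd Gcd ((*) c ` (a ` {..<N}))"
    by (rule Gcd_greatest) (use dc in \<open>auto simp: dvd_def intro: exI[of _ "\<Sum>i<N. E _ i"] dest: sym\<close>)
  then have "d dvd c"
    using gcd by (simp add: Gcd_mult)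
  then obtain D where "c = d * D" ..
  then show thesis
    using dc \<open>d > 0\<close> by (intro that[of D]) (simp add: mult.assoc)
qed

text \<open>The relation \<open>E b = I + a t\<^sup>T\<close> implies that every row of \<open>(b E - I) b\<close> is \<open>d t\<close>.  As \<open>b\<close> is
  invertible, all rows of \<open>b E - I\<close> are equal too.  Their common entry in column \<open>l\<close> is nonnegative,
  because a row other than the \<open>l\<close>-th shows it as an entry of \<open>b E\<close>.\<close>

lemma exponent_inverse_right:
  fixes b E :: "nat \<Rightarrow> nat \<Rightarrow> nat" and a t :: "nat \<Rightarrow> nat"
  assumes "N > 1"
    and det: "det (mat N N (\<lambda>(i, j). int (b i j))) \<noteq> 0"
    and weight: "\<And>i. i < N \<Longrightarrow> (\<Sum>j<N. b i j * a j) = d"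
    and EB: "\<And>j l. j < N \<Longrightarrow> l < N \<Longrightarrow>
      (\<Sum>i<N. E j i * b i l) = (if j = l then 1 else 0) + a j * t l"
  obtains u where "\<And>i l. i < N \<Longrightarrow> l < N \<Longrightarrow>
      (\<Sum>j<N. b i j * E j l) = (if i = l then 1 else 0) + u l"
proof -
  define Y where "Y i l = int (\<Sum>j<N. b i j * E j l) - (if i = l then 1 else 0)" for i l
  have YB: "(\<Sum>l<N. Y i l * int (b l k)) = int (d * t k)" if "i < N" "k < N" for i k
  proof -
    have "(\<Sum>l<N. (\<Sum>j<N. b i j * E j l) * b l k) = (\<Sum>j<N. b i j * (\<Sum>l<N. E j l * b l k))"
      unfolding sum_distrib_left sum_distrib_right by (subst sum.swap) (simp add: mult.assoc)
    also have "\<dots> = (\<Sum>j<N. (if j = k then b i k else 0) + b i j * a j * t k)"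
      using EB that by (intro sum.cong) (auto simp: distrib_left mult.assoc)
    also have "\<dots> = b i k + d * t k"
      using that weight[OF that(1)] by (simp add: sum.distrib flip: sum_distrib_right)
    finally have "(\<Sum>l<N. (\<Sum>j<N. b i j * E j l) * b l k) = b i k + d * t k" .
    then have 1: "(\<Sum>l<N. int (\<Sum>j<N. b i j * E j l) * int (b l k)) = int (b i k + d * t k)"
      by (metis (mono_tags, lifting) of_nat_mult of_nat_sum sum.cong)
    have "(\<Sum>l<N. Y i l * int (b l k)) = (\<Sum>l<N. int (\<Sum>j<N. b i j * E j l) * int (b l k)
        - (if l = i then int (b i k) else 0))"
      by (intro sum.cong) (auto simp: Y_def left_diff_distrib)
    also have "\<dots> = int (b i k + d * t k) - int (b i k)"
      using that unfolding sum_subtractf 1 by simp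
    finally show ?thesis by simp
  qed
  have Y: "Y i l = Y k l" if "i < N" "k < N" "l < N" for i k l
  proof -
    have "Y i l - Y k l = 0"
      using left_kernel_trivial[OF det, of "\<lambda>l. Y i l - Y k l" l] that YB
      by (simp add: left_diff_distrib sum_subtractf)
    then show ?thesis by simp
  qed
  show thesis
  proof (rule that[of "\<lambda>l. nat (Y 0 l)"])
    fix i l assume il: "i < N" "l < N"
    obtain k where "k < N" "k \<noteq> l"
      using \<open>N > 1\<close> by (metis gr_implies_not0 less_one neq0_conv order_less_trans)
    then have "Y 0 l \<ge> 0"
      using Y[of 0 k l] il by (simp add: Y_def sum_nonneg)
    then have "int (\<Sum>j<N. b i j * E j l) = int ((if i = l then 1 else 0) + nat (Y 0 l))"
      using Y[of i 0 l] il unfolding Y_def[of i l] by (auto split: if_splits)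
    then show "(\<Sum>j<N. b i j * E j l) = (if i = l then 1 else 0) + nat (Y 0 l)"
      by (simp only: of_nat_eq_iff)
  qed
qed

section \<open>Values of weighted homogeneous polynomials\<close>

lemma eval_mvpoly_superset:
  assumes "finite S" "Poly_Mapping.keys p \<subseteq> S"
  shows "eval_mvpoly p x = (\<Sum>m\<in>S. to_ac (Poly_Mapping.lookup p m) *
    (\<Prod>i\<in>Poly_Mapping.keys m. x i ^ Poly_Mapping.lookup m i))"
  unfolding eval_mvpoly_def using assms
  by (intro sum.mono_neutral_left) (auto simp: in_keys_iff)

lemma eval_mvpoly_zero [simp]: "eval_mvpoly 0 x = 0"
  by (simp add: eval_mvpoly_def)

lemma eval_mvpoly_add: "eval_mvpoly (p + q) x = eval_mvpoly p x + eval_mvpoly q x"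
proof -
  let ?S = "Poly_Mapping.keys p \<union> Poly_Mapping.keys q"
  have "finite ?S" "Poly_Mapping.keys p \<subseteq> ?S" "Poly_Mapping.keys q \<subseteq> ?S"
    "Poly_Mapping.keys (p + q) \<subseteq> ?S"
    using Poly_Mapping.keys_add[of p q] by auto
  then show ?thesis
    by (simp add: eval_mvpoly_superset[of ?S] lookup_add distrib_right sum.distrib)
qed

lemma eval_mvpoly_sum: "eval_mvpoly (\<Sum>i\<in>I. p i) x = (\<Sum>i\<in>I. eval_mvpoly (p i) x)"
  by (induction I rule: infinite_finite_induct) (auto simp: eval_mvpoly_add)

lemma eval_mvpoly_single:
  "eval_mvpoly (Poly_Mapping.single m c) x
    = to_ac c * (\<Prod>i\<in>Poly_Mapping.keys m. x i ^ Poly_Mapping.lookup m i)"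
  by (subst eval_mvpoly_superset[of "{m}"]) auto

lemma monomial_value_superset:
  fixes x :: "nat \<Rightarrow> 'r::comm_semiring_1"
  assumes "finite S" "Poly_Mapping.keys m \<subseteq> S"
  shows "(\<Prod>i\<in>Poly_Mapping.keys m. x i ^ Poly_Mapping.lookup m i) = (\<Prod>i\<in>S. x i ^ Poly_Mapping.lookup m i)"
  using assms by (intro prod.mono_neutral_left) (auto simp: in_keys_iff)

lemma monomial_value_add:
  fixes x :: "nat \<Rightarrow> 'r::comm_semiring_1"
  shows "(\<Prod>i\<in>Poly_Mapping.keys (m + m'). x i ^ Poly_Mapping.lookup (m + m') i)
    = (\<Prod>i\<in>Poly_Mapping.keys m. x i ^ Poly_Mapping.lookup m i) *
      (\<Prod>i\<in>Poly_Mapping.keys m'. x i ^ Poly_Mapping.lookup m' i)"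
proof -
  let ?S = "Poly_Mapping.keys m \<union> Poly_Mapping.keys m'"
  have "finite ?S" "Poly_Mapping.keys m \<subseteq> ?S" "Poly_Mapping.keys m' \<subseteq> ?S"
    "Poly_Mapping.keys (m + m') \<subseteq> ?S"
    using Poly_Mapping.keys_add[of m m'] by auto
  note this(2-4)[THEN monomial_value_superset[OF this(1), where x = x]]
  then show ?thesis
    by (simp only: lookup_add power_add prod.distrib)
qed

lemma mvpoly_sum_monomials:
  "p = (\<Sum>m\<in>Poly_Mapping.keys p. Poly_Mapping.single m (Poly_Mapping.lookup p m))"
proof (rule poly_mapping_eqI)
  fix k
  have "(\<Sum>m\<in>Poly_Mapping.keys p. Poly_Mapping.lookup (Poly_Mapping.single m (Poly_Mapping.lookup p m)) k)
    = (\<Sum>m\<in>Poly_Mapping.keys p. if m = k then Poly_Mapping.lookup p k else 0)"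
    by (intro sum.cong) (auto simp: lookup_single when_def)
  then show "Poly_Mapping.lookup p k = Poly_Mapping.lookup
      (\<Sum>m\<in>Poly_Mapping.keys p. Poly_Mapping.single m (Poly_Mapping.lookup p m)) k"
    by (simp add: lookup_sum in_keys_iff)
qed

lemma eval_mvpoly_mult: "eval_mvpoly (p * q) x = eval_mvpoly p x * eval_mvpoly q x"
proof -
  have "p * q = (\<Sum>m\<in>Poly_Mapping.keys p. \<Sum>m'\<in>Poly_Mapping.keys q.
      Poly_Mapping.single (m + m') (Poly_Mapping.lookup p m * Poly_Mapping.lookup q m'))"
    by (subst (1) mvpoly_sum_monomials[of p], subst (1) mvpoly_sum_monomials[of q])
      (simp add: sum_product mult_single)
  then have "eval_mvpoly (p * q) x = (\<Sum>m\<in>Poly_Mapping.keys p. \<Sum>m'\<in>Poly_Mapping.keys q.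
      (to_ac (Poly_Mapping.lookup p m) * (\<Prod>i\<in>Poly_Mapping.keys m. x i ^ Poly_Mapping.lookup m i)) *
      (to_ac (Poly_Mapping.lookup q m') * (\<Prod>i\<in>Poly_Mapping.keys m'. x i ^ Poly_Mapping.lookup m' i)))"
    by (simp add: eval_mvpoly_sum eval_mvpoly_single monomial_value_add mult_ac)
  then show ?thesis
    by (simp add: eval_mvpoly_def sum_product)
qed

lemma eval_mvpoly_scale:
  assumes g: "weighted_homogeneous N a d g" and y: "\<And>i. i < N \<Longrightarrow> y i = t ^ a i * x i"
  shows "eval_mvpoly g y = t ^ d * eval_mvpoly g x"
proof -
  have "(\<Prod>i\<in>Poly_Mapping.keys m. y i ^ Poly_Mapping.lookup m i)
      = t ^ d * (\<Prod>i\<in>Poly_Mapping.keys m. x i ^ Poly_Mapping.lookup m i)"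
    if "m \<in> Poly_Mapping.keys g" for m
  proof -
    have m: "Poly_Mapping.keys m \<subseteq> {..<N}"
      "(\<Sum>i\<in>Poly_Mapping.keys m. Poly_Mapping.lookup m i * a i) = d"
      using g that by (auto simp: weighted_homogeneous_def)
    have "(\<Prod>i\<in>Poly_Mapping.keys m. y i ^ Poly_Mapping.lookup m i)
      = (\<Prod>i\<in>Poly_Mapping.keys m. t ^ (Poly_Mapping.lookup m i * a i) * x i ^ Poly_Mapping.lookup m i)"
      using m(1) y by (intro prod.cong) (auto simp: power_mult_distrib power_mult mult.commute)
    also have "\<dots> = t ^ (\<Sum>i\<in>Poly_Mapping.keys m. Poly_Mapping.lookup m i * a i) *
        (\<Prod>i\<in>Poly_Mapping.keys m. x i ^ Poly_Mapping.lookup m i)"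
      by (simp add: prod.distrib power_sum)
    finally show ?thesis using m(2) by simp
  qed
  then show ?thesis
    by (simp add: eval_mvpoly_def sum_distrib_left mult.left_commute)
qed

text \<open>A form is treated as the function that it induces on vectors over the algebraic closure; what
  matters about its coefficients is only that they come from the ground field.\<close>

definition weighted_form ::
  "nat \<Rightarrow> (nat \<Rightarrow> nat) \<Rightarrow> nat \<Rightarrow> ((nat \<Rightarrow> 'a::field alg_closure) \<Rightarrow> 'a alg_closure) \<Rightarrow> bool" where
  "weighted_form N a d F \<longleftrightarrow> (\<exists>g :: 'a mvpoly. weighted_homogeneous N a d g \<and> F = eval_mvpoly g)"

lemma weighted_form_eval: "weighted_homogeneous N a d g \<Longrightarrow> weighted_form N a d (eval_mvpoly g)"
  by (auto simp: weighted_form_def)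

lemma weighted_form_const: "weighted_form N a 0 (\<lambda>_. to_ac c)"
  unfolding weighted_form_def
  by (rule exI[of _ "Poly_Mapping.single 0 c"])
    (auto simp: weighted_homogeneous_def eval_mvpoly_single fun_eq_iff)

lemma weighted_form_var: "i < N \<Longrightarrow> weighted_form N a (a i) (\<lambda>x. x i)"
  unfolding weighted_form_def
  by (rule exI[of _ "Poly_Mapping.single (Poly_Mapping.single i 1) 1"])
    (auto simp: weighted_homogeneous_def eval_mvpoly_single fun_eq_iff)

lemma weighted_form_add:
  assumes "weighted_form N a d F" "weighted_form N a d G"
  shows "weighted_form N a d (\<lambda>x. F x + G x)"
proof -
  obtain p q where "weighted_homogeneous N a d p" "F = eval_mvpoly p"
    "weighted_homogeneous N a d q" "G = eval_mvpoly q"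
    using assms by (auto simp: weighted_form_def)
  moreover from this have "weighted_homogeneous N a d (p + q)"
    using Poly_Mapping.keys_add[of p q] by (fastforce simp: weighted_homogeneous_def)
  ultimately show ?thesis
    unfolding weighted_form_def by (intro exI[of _ "p + q"]) (auto simp: eval_mvpoly_add)
qed

lemma monomial_weight_add:
  fixes a :: "nat \<Rightarrow> nat"
  shows "(\<Sum>i\<in>Poly_Mapping.keys (m + m'). Poly_Mapping.lookup (m + m') i * a i)
    = (\<Sum>i\<in>Poly_Mapping.keys m. Poly_Mapping.lookup m i * a i)
      + (\<Sum>i\<in>Poly_Mapping.keys m'. Poly_Mapping.lookup m' i * a i)"
proof -
  let ?S = "Poly_Mapping.keys m \<union> Poly_Mapping.keys m'"
  have superset: "(\<Sum>i\<in>Poly_Mapping.keys k. Poly_Mapping.lookup k i * a i) = (\<Sum>i\<in>?S. Poly_Mapping.lookup k i * a i)"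
    if "Poly_Mapping.keys k \<subseteq> ?S" for k
    using that by (intro sum.mono_neutral_left) (auto simp: in_keys_iff)
  have "Poly_Mapping.keys (m + m') \<subseteq> ?S"
    using Poly_Mapping.keys_add[of m m'] by auto
  from superset[OF this] superset[of m] superset[of m'] show ?thesis
    by (simp add: distrib_right sum.distrib lookup_add[of m m'])
qed

lemma weighted_form_mult:
  assumes "weighted_form N a d F" "weighted_form N a e G"
  shows "weighted_form N a (d + e) (\<lambda>x. F x * G x)"
proof -
  obtain p q where pq: "weighted_homogeneous N a d p" "F = eval_mvpoly p"
    "weighted_homogeneous N a e q" "G = eval_mvpoly q"
    using assms by (auto simp: weighted_form_def)
  have "weighted_homogeneous N a (d + e) (p * q)"
    unfolding weighted_homogeneous_def
  proof
    fix k assume "k \<in> Poly_Mapping.keys (p * q)"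
    then obtain m m' where "k = m + m'" "m \<in> Poly_Mapping.keys p" "m' \<in> Poly_Mapping.keys q"
      using Poly_Mapping.keys_mult[of p q] by blast
    then show "Poly_Mapping.keys k \<subseteq> {..<N} \<and>
        (\<Sum>i\<in>Poly_Mapping.keys k. Poly_Mapping.lookup k i * a i) = d + e"
      using pq Poly_Mapping.keys_add[of m m']
      by (force simp: weighted_homogeneous_def monomial_weight_add)
  qed
  then show ?thesis
    unfolding weighted_form_def using pq by (intro exI[of _ "p * q"]) (auto simp: eval_mvpoly_mult)
qed

lemma weighted_form_prod:
  "(\<And>i. i \<in> I \<Longrightarrow> weighted_form N a (d i) (\<lambda>x. F x i)) \<Longrightarrow>
    weighted_form N a (\<Sum>i\<in>I. d i) (\<lambda>x. \<Prod>i\<in>I. F x i)"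
  using weighted_form_const[of N a 1]
  by (induction I rule: infinite_finite_induct) (auto intro: weighted_form_mult)

lemma weighted_form_power:
  "weighted_form N a d F \<Longrightarrow> weighted_form N a (k * d) (\<lambda>x. F x ^ k)"
  using weighted_form_const[of N a 1]
  by (induction k) (auto intro: weighted_form_mult)

lemma weighted_form_zero: "weighted_form N a d (\<lambda>_. 0)"
  unfolding weighted_form_def by (rule exI[of _ 0]) (auto simp: weighted_homogeneous_def)

lemma weighted_form_sum:
  "(\<And>i. i \<in> I \<Longrightarrow> weighted_form N a d (\<lambda>x. F x i)) \<Longrightarrow>
    weighted_form N a d (\<lambda>x. \<Sum>i\<in>I. F x i)"
  by (induction I rule: infinite_finite_induct) (auto intro: weighted_form_add weighted_form_zero)

lemma weighted_form_cmult:
  "weighted_form N a d F \<Longrightarrow> weighted_form N a d (\<lambda>x. to_ac c * F x)"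
  using weighted_form_mult[OF weighted_form_const] by fastforce

lemma weighted_form_compose:
  assumes p: "\<And>j. j < M \<Longrightarrow> weighted_form N a (D * b j) (\<lambda>x. p x j)"
    and G: "weighted_form M b e G"
  shows "weighted_form N a (D * e) (\<lambda>x. G (p x))"
proof -
  obtain g where g: "weighted_homogeneous M b e g" and G: "G = eval_mvpoly g"
    using G by (auto simp: weighted_form_def)
  show ?thesis
    unfolding G eval_mvpoly_def
  proof (intro weighted_form_sum weighted_form_cmult)
    fix m assume "m \<in> Poly_Mapping.keys g"
    then have m: "Poly_Mapping.keys m \<subseteq> {..<M}"
      "(\<Sum>i\<in>Poly_Mapping.keys m. Poly_Mapping.lookup m i * b i) = e"
      using g by (auto simp: weighted_homogeneous_def)
    have "weighted_form N a (\<Sum>i\<in>Poly_Mapping.keys m. Poly_Mapping.lookup m i * (D * b i))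
        (\<lambda>x. \<Prod>i\<in>Poly_Mapping.keys m. p x i ^ Poly_Mapping.lookup m i)"
      using p m(1) by (intro weighted_form_prod weighted_form_power) auto
    moreover have "(\<Sum>i\<in>Poly_Mapping.keys m. Poly_Mapping.lookup m i * (D * b i)) = D * e"
      by (simp add: sum_distrib_left mult.left_commute flip: m(2))
    ultimately show "weighted_form N a (D * e)
        (\<lambda>x. \<Prod>i\<in>Poly_Mapping.keys m. p x i ^ Poly_Mapping.lookup m i)"
      by simp
  qed
qed

lemma weighted_form_scale:
  assumes "weighted_form N a d F" and "\<And>i. i < N \<Longrightarrow> y i = t ^ a i * x i"
  shows "F y = t ^ d * F x"
  using assms eval_mvpoly_scale by (fastforce simp: weighted_form_def)

section \<open>Points and open sets of weighted projective space\<close>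

lemma weighted_relI:
  "x \<in> nonzero_vectors N \<Longrightarrow> y \<in> nonzero_vectors N \<Longrightarrow> t \<noteq> 0 \<Longrightarrow> (\<And>i. y i = t ^ a i * x i) \<Longrightarrow>
    (x, y) \<in> weighted_rel N a"
  unfolding weighted_rel_def by blast

lemma weighted_relE:
  assumes "(x, y) \<in> weighted_rel N a"
  obtains t where "t \<noteq> 0" "\<And>i. y i = t ^ a i * x i"
  using assms unfolding weighted_rel_def by blast

lemma weighted_rel_nonzero:
  "(x, y) \<in> weighted_rel N a \<Longrightarrow> x \<in> nonzero_vectors N \<and> y \<in> nonzero_vectors N"
  by (simp add: weighted_rel_def)

lemma equiv_weighted_rel:
  "equiv (nonzero_vectors N) (weighted_rel N a :: ((nat \<Rightarrow> 'a::field alg_closure) \<times> _) set)"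
proof (rule equivI)
  show "(weighted_rel N a :: ((nat \<Rightarrow> 'a alg_closure) \<times> _) set) \<subseteq> nonzero_vectors N \<times> nonzero_vectors N"
    using weighted_rel_nonzero by fast
  show "refl_on (nonzero_vectors N) (weighted_rel N a :: ((nat \<Rightarrow> 'a alg_closure) \<times> _) set)"
    by (rule refl_onI) (rule weighted_relI[where t = 1], simp_all)
  show "sym (weighted_rel N a :: ((nat \<Rightarrow> 'a alg_closure) \<times> _) set)"
  proof (rule symI)
    fix x y :: "nat \<Rightarrow> 'a alg_closure"
    assume xy: "(x, y) \<in> weighted_rel N a"
    then obtain t where t: "t \<noteq> 0" "\<And>i. y i = t ^ a i * x i"
      by (rule weighted_relE) blast
    then show "(y, x) \<in> weighted_rel N a"
      using weighted_rel_nonzero[OF xy]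
      by (intro weighted_relI[of _ _ _ "inverse t"]) (simp_all add: power_inverse)
  qed
  show "trans (weighted_rel N a :: ((nat \<Rightarrow> 'a alg_closure) \<times> _) set)"
  proof (rule transI)
    fix x y z :: "nat \<Rightarrow> 'a alg_closure"
    assume xy: "(x, y) \<in> weighted_rel N a" and yz: "(y, z) \<in> weighted_rel N a"
    obtain t where t: "t \<noteq> 0" "\<And>i. y i = t ^ a i * x i"
      using xy by (rule weighted_relE) blast
    obtain u where u: "u \<noteq> 0" "\<And>i. z i = u ^ a i * y i"
      using yz by (rule weighted_relE) blast
    show "(x, z) \<in> weighted_rel N a"
      using weighted_rel_nonzero[OF xy] weighted_rel_nonzero[OF yz]
      by (intro weighted_relI[of _ _ _ "u * t"]) (use t u in \<open>simp_all add: power_mult_distrib\<close>)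
  qed
qed

lemma wproj_rel:
  assumes "P \<in> wproj N a" "x \<in> P" "y \<in> P"
  shows "(x, y) \<in> weighted_rel N a"
  using assms quotient_eq_iff[OF equiv_weighted_rel] unfolding wproj_def by blast

lemma wproj_mem_nonzero: "P \<in> wproj N a \<Longrightarrow> x \<in> P \<Longrightarrow> x \<in> nonzero_vectors N"
  using wproj_rel[of P N a x x] weighted_rel_nonzero by blast

lemma wproj_nonempty: "P \<in> wproj N a \<Longrightarrow> \<exists>x. x \<in> P"
  unfolding wproj_def using in_quotient_imp_non_empty[OF equiv_weighted_rel] by fastforce

lemma wproj_eqI: "P \<in> wproj N a \<Longrightarrow> Q \<in> wproj N a \<Longrightarrow> x \<in> P \<Longrightarrow> y \<in> Q \<Longrightarrow>
    (x, y) \<in> weighted_rel N a \<Longrightarrow> P = Q"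
  unfolding wproj_def using quotient_eqI[OF equiv_weighted_rel] by blast

lemma wproj_class: "x \<in> nonzero_vectors N \<Longrightarrow> weighted_rel N a `` {x} \<in> wproj N a"
  unfolding wproj_def by (rule quotientI)

lemma wproj_class_mem: "x \<in> nonzero_vectors N \<Longrightarrow> x \<in> weighted_rel N a `` {x}"
  by (rule equiv_class_self[OF equiv_weighted_rel])

lemma weighted_form_zero_iff:
  assumes F: "weighted_form N a d F" and "P \<in> wproj N a" "x \<in> P" "y \<in> P"
  shows "F x = 0 \<longleftrightarrow> F y = 0"
proof -
  obtain t where "t \<noteq> 0" "\<And>i. y i = t ^ a i * x i"
    using wproj_rel[OF assms(2-4)] by (rule weighted_relE) blast
  then show ?thesis
    using weighted_form_scale[OF F, of y t x] by simp
qed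

definition nonvanishing :: "nat \<Rightarrow> (nat \<Rightarrow> nat) \<Rightarrow>
    ((nat \<Rightarrow> 'a::field alg_closure) \<Rightarrow> 'a alg_closure) \<Rightarrow> 'a wpoint set" where
  "nonvanishing N a F = {P \<in> wproj N a. \<forall>x\<in>P. F x \<noteq> 0}"

lemma nonvanishing_iff:
  assumes "weighted_form N a d F" "P \<in> wproj N a" "x \<in> P"
  shows "P \<in> nonvanishing N a F \<longleftrightarrow> F x \<noteq> 0"
  using assms weighted_form_zero_iff[OF assms(1,2)] unfolding nonvanishing_def by blast

lemma zariski_alt:
  "zariski N a = topology_generated_by {nonvanishing N a F |d F. weighted_form N a d F}"
  unfolding zariski_def nonvanishing_def weighted_form_def
  by (rule arg_cong[where f = topology_generated_by]) blast

lemma openin_nonvanishing: "weighted_form N a d F \<Longrightarrow> openin (zariski N a) (nonvanishing N a F)"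
  unfolding zariski_alt by (rule topology_generated_by_Basis) blast

lemma topspace_zariski [simp]: "topspace (zariski N a) = wproj N a"
proof
  show "topspace (zariski N a) \<subseteq> (wproj N a :: 'a wpoint set)"
    by (auto simp: zariski_alt topology_generated_by_topspace nonvanishing_def)
  have "nonvanishing N a (\<lambda>_. to_ac (1 :: 'a)) = wproj N a"
    by (simp add: nonvanishing_def)
  then show "wproj N a \<subseteq> (topspace (zariski N a) :: 'a wpoint set)"
    using openin_subset[OF openin_nonvanishing[OF weighted_form_const[of N a "1 :: 'a"]]] by simp
qed

section \<open>Maps given by forms\<close>

text \<open>The image of a whole orbit is taken, so that no representative has to be chosen.\<close>

definition induced_map :: "nat \<Rightarrow> (nat \<Rightarrow> nat) \<Rightarrow>
    ((nat \<Rightarrow> 'a::field alg_closure) \<Rightarrow> nat \<Rightarrow> 'a alg_closure) \<Rightarrow> 'a wpoint \<Rightarrow> 'a wpoint" where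
  "induced_map M b p P = weighted_rel M b `` (p ` P)"

text \<open>A scalar \<open>t\<close> acting on \<open>x\<close> becomes the scalar \<open>t\<^sup>D\<close> acting on \<open>p x\<close>, so an orbit goes to one orbit.\<close>

lemma induced_map_class:
  assumes p: "\<And>j. j < M \<Longrightarrow> weighted_form N a (D * b j) (\<lambda>x. p x j)"
    and nz: "\<And>x. x \<in> P \<Longrightarrow> p x \<in> nonzero_vectors M"
    and P: "P \<in> wproj N a" and x: "x \<in> P"
  shows "induced_map M b p P \<in> wproj M b" and "p x \<in> induced_map M b p P"
proof -
  have "(p x, p y) \<in> weighted_rel M b" if y: "y \<in> P" for y
  proof -
    obtain t where t: "t \<noteq> 0" "\<And>i. y i = t ^ a i * x i"
      using wproj_rel[OF P x y] by (rule weighted_relE) blast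
    have "p y j = (t ^ D) ^ b j * p x j" for j
    proof (cases "j < M")
      case True
      from weighted_form_scale[OF p[OF this] t(2)] show ?thesis by (simp add: power_mult)
    next
      case False
      then show ?thesis using nz[OF x] nz[OF y] by (simp add: nonzero_vectors_def)
    qed
    then show ?thesis
      using nz[OF x] nz[OF y] t(1) by (intro weighted_relI[of _ _ _ "t ^ D"]) auto
  qed
  then have "weighted_rel M b `` {p y} = weighted_rel M b `` {p x}" if "y \<in> P" for y
    using equiv_class_eq[OF equiv_weighted_rel] that by metis
  then have "induced_map M b p P = weighted_rel M b `` {p x}"
    using x unfolding induced_map_def by blast
  then show "induced_map M b p P \<in> wproj M b" "p x \<in> induced_map M b p P"
    using nz[OF x] wproj_class wproj_class_mem by auto
qed

text \<open>Composing a form on the target with \<open>p\<close> gives a form on the source.  So the preimage of a basic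
  open set is the trace of a basic open set on \<open>U\<close>, and quotients of forms of equal degree pull back to such quotients.\<close>

lemma morphism_on_induced_map:
  assumes p: "\<And>j. j < M \<Longrightarrow> weighted_form N a (D * b j) (\<lambda>x. p x j)"
    and U: "U \<subseteq> wproj N a" and V: "V \<subseteq> wproj M b"
    and nz: "\<And>P x. P \<in> U \<Longrightarrow> x \<in> P \<Longrightarrow> p x \<in> nonzero_vectors M"
    and UV: "\<And>P. P \<in> U \<Longrightarrow> induced_map M b p P \<in> V"
  shows "morphism_on N a U M b V (induced_map M b p)"
proof -
  let ?\<phi> = "induced_map M b p"
  have mem: "p x \<in> ?\<phi> P" if "P \<in> U" "x \<in> P" for P x
  proof -
    have "P \<in> wproj N a"
      using that U by blast
    show ?thesis
      by (rule induced_map_class(2)[OF p nz[OF that(1)] \<open>P \<in> wproj N a\<close> that(2)])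
  qed
  have \<phi>: "?\<phi> P \<in> wproj M b" if "P \<in> U" for P
    using UV[OF that] V by blast
  have top: "topspace (subtopology (zariski N a) U) = U"
    using U by auto
  have cont: "continuous_map (subtopology (zariski N a) U) (zariski M b) ?\<phi>"
    unfolding zariski_alt[of M b]
  proof (rule continuous_on_generated_topo)
    fix O' :: "'a wpoint set"
    assume "O' \<in> {nonvanishing M b F |d F. weighted_form M b d F}"
    then obtain e G where G: "weighted_form M b e G" and O': "O' = nonvanishing M b G"
      by blast
    have comp: "weighted_form N a (D * e) (\<lambda>x. G (p x))"
      using p G by (rule weighted_form_compose)
    have "P \<in> nonvanishing N a (\<lambda>x. G (p x)) \<longleftrightarrow> ?\<phi> P \<in> O'" if P: "P \<in> U" for P
    proof -
      obtain x where x: "x \<in> P"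
        using wproj_nonempty P U by blast
      have "P \<in> wproj N a"
        using P U by blast
      from nonvanishing_iff[OF comp this x] nonvanishing_iff[OF G \<phi>[OF P] mem[OF P x]]
      show ?thesis
        by (simp add: O')
    qed
    then have "?\<phi> -` O' \<inter> topspace (subtopology (zariski N a) U) = nonvanishing N a (\<lambda>x. G (p x)) \<inter> U"
      unfolding top by blast
    then show "openin (subtopology (zariski N a) U)
        (?\<phi> -` O' \<inter> topspace (subtopology (zariski N a) U))"
      using openin_nonvanishing[OF comp] by (auto simp: openin_subtopology)
  next
    show "?\<phi> ` topspace (subtopology (zariski N a) U)
        \<subseteq> \<Union> {nonvanishing M b F |d F. weighted_form M b d F}"
      using \<phi> unfolding top topology_generated_by_topspace[symmetric] zariski_alt[symmetric] by auto
  qed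
  show ?thesis
    unfolding morphism_on_def
  proof (intro conjI allI impI)
    show "continuous_map (subtopology (zariski N a) U) (subtopology (zariski M b) V) ?\<phi>"
      using cont UV top by (auto simp: continuous_map_in_subtopology)
  next
    fix W s
    assume "openin (subtopology (zariski M b) V) W \<and> regular_on M b W s"
    then have s: "regular_on M b W s" by blast
    show "regular_on N a {P \<in> U. ?\<phi> P \<in> W} (s \<circ> ?\<phi>)"
      unfolding regular_on_def
    proof
      fix P assume "P \<in> {P \<in> U. ?\<phi> P \<in> W}"
      then have P: "P \<in> U" "?\<phi> P \<in> W" by auto
      obtain W' e g h where W': "openin (subtopology (zariski M b) W) W'" "?\<phi> P \<in> W'"
        and gh: "weighted_homogeneous M b e (g :: 'a mvpoly)" "weighted_homogeneous M b e (h :: 'a mvpoly)"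
        and quot: "\<And>Q x. Q \<in> W' \<Longrightarrow> x \<in> Q \<Longrightarrow>
          eval_mvpoly h x \<noteq> 0 \<and> s Q = eval_mvpoly g x / eval_mvpoly h x"
        using s P(2) unfolding regular_on_def by meson
      obtain O' where O': "openin (zariski M b) O'" "W' = O' \<inter> W"
        using W'(1) by (auto simp: openin_subtopology)
      obtain O'' where O'': "openin (zariski N a) O''" "{P \<in> U. ?\<phi> P \<in> O'} = O'' \<inter> U"
        using openin_continuous_map_preimage[OF cont O'(1)] unfolding top openin_subtopology by blast
      obtain g' where g': "weighted_homogeneous N a (D * e) g'" "(\<lambda>x. eval_mvpoly g (p x)) = eval_mvpoly g'"
        using weighted_form_compose[OF p weighted_form_eval[OF gh(1)]] by (auto simp: weighted_form_def)
      obtain h' where h': "weighted_homogeneous N a (D * e) h'" "(\<lambda>x. eval_mvpoly h (p x)) = eval_mvpoly h'"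
        using weighted_form_compose[OF p weighted_form_eval[OF gh(2)]] by (auto simp: weighted_form_def)
      let ?W = "{P \<in> U. ?\<phi> P \<in> W'}"
      have W_eq: "?W = O'' \<inter> {P \<in> U. ?\<phi> P \<in> W}"
        using O'(2) O''(2) by blast
      have W_open: "openin (subtopology (zariski N a) {P \<in> U. ?\<phi> P \<in> W}) ?W"
        unfolding W_eq by (rule openin_subtopology_Int[OF O''(1)])
      have P_W: "P \<in> ?W"
        using P W'(2) by simp
      have quotient: "\<forall>Q\<in>?W. \<forall>x\<in>Q.
          eval_mvpoly h' x \<noteq> 0 \<and> (s \<circ> ?\<phi>) Q = eval_mvpoly g' x / eval_mvpoly h' x"
      proof (intro ballI)
        fix Q x assume "Q \<in> ?W" "x \<in> Q"
        then have "?\<phi> Q \<in> W'" "p x \<in> ?\<phi> Q"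
          using mem by auto
        from quot[OF this] show "eval_mvpoly h' x \<noteq> 0 \<and> (s \<circ> ?\<phi>) Q = eval_mvpoly g' x / eval_mvpoly h' x"
          using fun_cong[OF g'(2), of x] fun_cong[OF h'(2), of x] by simp
      qed
      show "\<exists>O' d g h. openin (subtopology (zariski N a) {P \<in> U. ?\<phi> P \<in> W}) O' \<and> P \<in> O' \<and>
          weighted_homogeneous N a d g \<and> weighted_homogeneous N a d h \<and>
          (\<forall>Q\<in>O'. \<forall>x\<in>Q. eval_mvpoly h x \<noteq> 0 \<and> (s \<circ> ?\<phi>) Q = eval_mvpoly g x / eval_mvpoly h x)"
        by (intro exI conjI) (rule W_open P_W g'(1) h'(1) quotient)+
    qed
  qed
qed

section \<open>Parametrising the torus of a Delsarte hypersurface\<close>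

text \<open>This makes the torus part of the hyperplane nonempty.  It fails in a field with two elements, whereas
  the equation \<open>c (c - r) = -1\<close> can always be solved in an algebraically closed field.\<close>

lemma alg_closed_avoids:
  fixes r :: "'r::alg_closed_field"
  obtains c where "c \<noteq> 0" "c \<noteq> r"
proof -
  have "degree [:1, - r, 1:] > 0"
    by simp
  from alg_closed_imp_poly_has_root[OF this] obtain c where "poly [:1, - r, 1:] c = 0"
    by blast
  then have "1 + c * (c - r) = 0"
    by (simp add: algebra_simps)
  then show thesis
    by (intro that[of c]) auto
qed

lemma monomial_map_compose:
  fixes z :: "nat \<Rightarrow> 'r::comm_semiring_1"
  shows "(\<Prod>j<N. (\<Prod>i<M. z i ^ c j i) ^ e j) = (\<Prod>i<M. z i ^ (\<Sum>j<N. e j * c j i))"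
proof -
  have "(\<Prod>j<N. (\<Prod>i<M. z i ^ c j i) ^ e j) = (\<Prod>j<N. \<Prod>i<M. z i ^ (e j * c j i))"
    by (simp add: prod_power_distrib mult.commute flip: power_mult)
  also have "\<dots> = (\<Prod>i<M. \<Prod>j<N. z i ^ (e j * c j i))"
    by (rule prod.swap)
  finally show ?thesis
    by (simp add: power_sum)
qed

lemma prod_power_delta_add:
  fixes z :: "nat \<Rightarrow> 'r::comm_semiring_1"
  assumes "k < N"
  shows "(\<Prod>i<N. z i ^ ((if k = i then 1 else 0) + s i)) = z k * (\<Prod>i<N. z i ^ s i)"
proof -
  have "(\<Prod>i<N. z i ^ ((if k = i then 1 else 0) + s i))
    = (\<Prod>i<N. (if k = i then z i else 1) * z i ^ s i)"
    by (intro prod.cong) auto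
  then show ?thesis
    using assms by (simp add: prod.distrib)
qed

lemma lookup_exponent_vector:
  fixes e :: "nat \<Rightarrow> 'r::comm_monoid_add"
  shows "Poly_Mapping.lookup (\<Sum>j<N. Poly_Mapping.single j (e j)) i = (if i < N then e i else 0)"
proof -
  have "Poly_Mapping.lookup (\<Sum>j<N. Poly_Mapping.single j (e j)) i = (\<Sum>j<N. if j = i then e i else 0)"
    unfolding lookup_sum by (intro sum.cong) (auto simp: lookup_single when_def)
  then show ?thesis
    by simp
qed

lemma keys_exponent_vector: "Poly_Mapping.keys (\<Sum>j<N. Poly_Mapping.single j (e j :: nat)) \<subseteq> {..<N::nat}"
  by (auto simp: in_keys_iff lookup_exponent_vector split: if_splits)

text \<open>Distinct rows give distinct monomials, so no terms cancel or merge: each row is the exponent vector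
  of a monomial that occurs in \<open>f\<close>, and so it has weight \<open>d\<close> if \<open>f\<close> is homogeneous of degree \<open>d\<close>.\<close>

lemma delsarte_expand:
  fixes f :: "'a::field mvpoly"
  assumes f: "delsarte N B f"
  obtains K :: "nat \<Rightarrow> 'a" where "\<And>i. i < N \<Longrightarrow> K i \<noteq> 0"
    and "\<And>x. eval_mvpoly f x = (\<Sum>i<N. to_ac (K i) * (\<Prod>j<N. x j ^ B $$ (i, j)))"
    and "\<And>a d i. weighted_homogeneous N a d f \<Longrightarrow> i < N \<Longrightarrow> (\<Sum>j<N. B $$ (i, j) * a j) = d"
proof -
  define m where "m i = (\<Sum>j<N. Poly_Mapping.single j (B $$ (i, j)))" for i
  have B: "B \<in> carrier_mat N N" and inj: "inj_on (row B) {..<N}"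
    using f by (auto simp: delsarte_def)
  obtain K where K: "\<And>i. i < N \<Longrightarrow> K i \<noteq> 0" and fK: "f = (\<Sum>i<N. Poly_Mapping.single (m i) (K i))"
    using f unfolding delsarte_def m_def by blast
  have m_keys: "Poly_Mapping.keys (m i) \<subseteq> {..<N}" for i
    unfolding m_def by (rule keys_exponent_vector)
  have m_lookup: "Poly_Mapping.lookup (m i) j = B $$ (i, j)" if "j < N" for i j
    using that by (simp add: m_def lookup_exponent_vector)
  have m_inj: "i = k" if "m i = m k" "i < N" "k < N" for i k
  proof -
    have "row B i = row B k"
    proof (rule eq_vecI)
      fix j assume "j < dim_vec (row B k)"
      then have "j < N" using B by simp
      then show "row B i $ j = row B k $ j"
        using that B m_lookup[of j i] m_lookup[of j k] by simp
    qed (use B in simp)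
    then show ?thesis
      using inj that by (auto simp: inj_on_def)
  qed
  show thesis
  proof (rule that[of K])
    show "K i \<noteq> 0" if "i < N" for i
      using K that .
    show "eval_mvpoly f x = (\<Sum>i<N. to_ac (K i) * (\<Prod>j<N. x j ^ B $$ (i, j)))" for x
      unfolding fK eval_mvpoly_sum eval_mvpoly_single
      using m_lookup by (simp add: monomial_value_superset[OF finite_lessThan m_keys])
  next
    fix a d i assume hom: "weighted_homogeneous N a d f" and i: "i < N"
    have "Poly_Mapping.lookup f (m i) = (\<Sum>k<N. if k = i then K i else 0)"
      unfolding fK lookup_sum using m_inj i by (intro sum.cong) (auto simp: lookup_single when_def)
    then have "m i \<in> Poly_Mapping.keys f"
      using K i by (simp add: in_keys_iff)
    then have "(\<Sum>j\<in>Poly_Mapping.keys (m i). Poly_Mapping.lookup (m i) j * a j) = d"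
      using hom by (auto simp: weighted_homogeneous_def)
    also have "(\<Sum>j\<in>Poly_Mapping.keys (m i). Poly_Mapping.lookup (m i) j * a j)
        = (\<Sum>j<N. Poly_Mapping.lookup (m i) j * a j)"
      using m_keys by (intro sum.mono_neutral_left) (auto simp: in_keys_iff)
    finally show "(\<Sum>j<N. B $$ (i, j) * a j) = d"
      using m_lookup by simp
  qed
qed

lemma det_map_of_nat:
  assumes B: "B \<in> carrier_mat N N"
  shows "det (map_mat of_nat B :: rat mat) = of_int (det (mat N N (\<lambda>(i, j). int (B $$ (i, j)))))"
proof -
  have "map_mat of_nat B = (map_mat of_int (mat N N (\<lambda>(i, j). int (B $$ (i, j)))) :: rat mat)"
    using B by (intro eq_matI) auto
  then show ?thesis
    by (simp add: of_int_hom.hom_det)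
qed

lemma det_nonzero_if_invertible:
  assumes A: "A \<in> carrier_mat N N" and "invertible_mat (A :: 'r::field mat)"
  shows "det A \<noteq> 0"
proof -
  obtain C where AC: "A * C = 1\<^sub>m N" and CA: "C * A = 1\<^sub>m (dim_row C)"
    using assms by (auto simp: invertible_mat_def inverts_mat_def)
  have "C \<in> carrier_mat N N"
    using arg_cong[OF AC, of dim_col] arg_cong[OF CA, of dim_col] A by auto
  then have "det A * det C = 1"
    using det_mult[OF A, of C] AC by simp
  then show ?thesis by auto
qed

text \<open>\<open>\<P>\<^sup>n\<close> is identified with the hyperplane \<open>\<Sum>\<^sub>i K\<^sub>i y\<^sub>i = 0\<close> by leaving out the last coordinate, which
  \<open>Y\<close> recovers from the others.  The map to \<open>\<P>\<^sup>n\<close> raises \<open>x\<close> to the exponents \<open>b\<close> and the map back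
  raises \<open>y\<close> to the exponents \<open>E\<close>.  By \<open>E b = I + a t\<^sup>T\<close> one composite multiplies \<open>x\<^sub>j\<close> by
  \<open>(x\<^sup>t)\<^bsup>a\<^sub>j\<^esup>\<close>, and as all rows of \<open>b E - I\<close> equal \<open>u\<close>, the other multiplies all \<open>y\<^sub>i\<close> by
  \<open>y\<^sup>u\<close>; neither changes the point.
  That all \<open>y\<^sub>i\<close> get the same factor also shows that the map back lands in \<open>X\<close>.\<close>

lemma rational_if_exponents_invertible:
  fixes f :: "'a::field mvpoly" and K :: "nat \<Rightarrow> 'a" and b E :: "nat \<Rightarrow> nat \<Rightarrow> nat"
  assumes hom: "weighted_homogeneous (n + 2) a d f"
    and K: "\<And>i. i < n + 2 \<Longrightarrow> K i \<noteq> 0"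
    and f: "\<And>x. eval_mvpoly f x = (\<Sum>i<n+2. to_ac (K i) * (\<Prod>j<n+2. x j ^ b i j))"
    and weight: "\<And>i. i < n + 2 \<Longrightarrow> (\<Sum>j<n+2. b i j * a j) = d"
    and EB: "\<And>j l. j < n + 2 \<Longrightarrow> l < n + 2 \<Longrightarrow>
      (\<Sum>i<n+2. E j i * b i l) = (if j = l then 1 else 0) + a j * t l"
    and BE: "\<And>i l. i < n + 2 \<Longrightarrow> l < n + 2 \<Longrightarrow>
      (\<Sum>j<n+2. b i j * E j l) = (if i = l then 1 else 0) + u l"
    and D: "\<And>j. j < n + 2 \<Longrightarrow> (\<Sum>i<n+2. E j i) = D * a j"
  shows "rational_variety (n + 2) a (hypersurface (n + 2) a f) n"
proof -
  define N where "N = n + 2"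
  note [folded N_def] = hom K f weight EB BE D
  note hom = this(1) and K = this(2) and f = this(3) and weight = this(4)
    and EB = this(5) and BE = this(6) and D = this(7)
  have N: "N = Suc (Suc n)" by (simp add: N_def)
  let ?one = "\<lambda>_::nat. 1::nat"
  define y where "y x i = (\<Prod>j<N. x j ^ b i j)" for x :: "nat \<Rightarrow> 'a alg_closure" and i
  define p where "p x i = (if i < n + 1 then y x i else 0)" for x i
  define L where "L w = (\<Sum>i<n+1. to_ac (K i) * w i)" for w
  \<comment> \<open>completes \<open>w\<close> to a point of the hyperplane\<close>
  define Y where "Y w i = (if i < n + 1 then w i else to_ac (- 1 / K (n + 1)) * L w)" for w i
  define q where "q w j = (if j < N then \<Prod>i<N. Y w i ^ E j i else 0)" for w j
  define G where "G x = (\<Prod>j<N. x j)" for x :: "nat \<Rightarrow> 'a alg_closure"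
  define H where "H w = (\<Prod>i<N. Y w i)" for w
  define Z where "Z = hypersurface N a f"
  define U where "U = Z \<inter> nonvanishing N a G"
  define V where "V = nonvanishing (n + 1) ?one H"
  have G: "weighted_form N a (\<Sum>j<N. a j) G"
    unfolding G_def by (intro weighted_form_prod weighted_form_var) auto
  have Y: "weighted_form (n + 1) ?one 1 (\<lambda>w. Y w i)" for i
  proof (cases "i < n + 1")
    case True
    then show ?thesis using weighted_form_var[of i "n + 1" ?one] by (simp add: Y_def)
  next
    case False
    have "weighted_form (n + 1) ?one 1 (\<lambda>w. to_ac (- 1 / K (n + 1)) * L w)"
      unfolding L_def
      by (intro weighted_form_cmult weighted_form_sum) (use weighted_form_var[of _ "n + 1" ?one] in auto)
    with False show ?thesis by (simp add: Y_def)
  qed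
  have H: "weighted_form (n + 1) ?one (\<Sum>i<N. 1) H"
    unfolding H_def by (intro weighted_form_prod Y)
  have p: "weighted_form N a (d * 1) (\<lambda>x. p x i)" if "i < n + 1" for i
  proof -
    have "weighted_form N a (\<Sum>j<N. b i j * a j) (\<lambda>x. y x i)"
      unfolding y_def by (intro weighted_form_prod weighted_form_power weighted_form_var) auto
    then show ?thesis
      using weight[of i] that by (simp add: p_def N)
  qed
  have q: "weighted_form (n + 1) ?one (D * a j) (\<lambda>w. q w j)" if "j < N" for j
  proof -
    have "weighted_form (n + 1) ?one (\<Sum>i<N. E j i * 1) (\<lambda>w. \<Prod>i<N. Y w i ^ E j i)"
      by (intro weighted_form_prod weighted_form_power Y)
    then show ?thesis
      using D[OF that] that by (simp add: q_def)
  qed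
  have sum_N: "(\<Sum>i<N. to_ac (K i) * z i) = L z + to_ac (K (n + 1)) * z (n + 1)"
    for z :: "nat \<Rightarrow> 'a alg_closure"
    by (simp add: N L_def)
  have Kn: "K (n + 1) \<noteq> 0"
    using K[of "n + 1"] by (simp add: N)
  have Y_hyperplane: "(\<Sum>i<N. to_ac (K i) * Y w i) = 0" for w
  proof -
    have LY: "L (Y w) = L w"
      by (simp add: L_def Y_def)
    have "to_ac (K (n + 1)) * Y w (n + 1) = to_ac (K (n + 1) * (- 1 / K (n + 1))) * L w"
      by (simp only: Y_def to_ac_mult mult.assoc) simp
    also have "K (n + 1) * (- 1 / K (n + 1)) = - 1"
      using Kn by simp
    finally show ?thesis
      unfolding sum_N LY by simp
  qed
  have Yp: "Y (p x) i = y x i" if "eval_mvpoly f x = 0" "i < N" for x i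
  proof -
    have "L (p x) = L (y x)"
      by (simp add: L_def p_def)
    moreover have "(\<Sum>i<N. to_ac (K i) * y x i) = 0"
      using that(1) by (simp only: f y_def)
    then have "L (y x) + to_ac (K (n + 1)) * y x (n + 1) = 0"
      by (simp only: sum_N[of "y x"])
    ultimately have "L (p x) = to_ac (- K (n + 1)) * y x (n + 1)"
      by (simp add: eq_neg_iff_add_eq_0)
    then have "to_ac (- 1 / K (n + 1)) * L (p x)
        = to_ac (- 1 / K (n + 1) * - K (n + 1)) * y x (n + 1)"
      by (simp only: to_ac_mult mult.assoc)
    also have "- 1 / K (n + 1) * - K (n + 1) = 1"
      using Kn by simp
    finally have "to_ac (- 1 / K (n + 1)) * L (p x) = y x (n + 1)"
      by simp
    moreover have "i < n + 1 \<or> i = n + 1"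
      using that(2) N by auto
    ultimately show ?thesis
      by (auto simp: Y_def p_def)
  qed
  have qp: "q (p x) j = (\<Prod>l<N. x l ^ t l) ^ a j * x j" if "eval_mvpoly f x = 0" "j < N" for x j
  proof -
    have "q (p x) j = (\<Prod>i<N. (\<Prod>l<N. x l ^ b i l) ^ E j i)"
      using that Yp by (simp add: q_def y_def)
    also have "\<dots> = (\<Prod>l<N. x l ^ ((if j = l then 1 else 0) + a j * t l))"
      unfolding monomial_map_compose using EB[OF that(2)] by (intro prod.cong) auto
    also have "\<dots> = x j * (\<Prod>l<N. x l ^ (a j * t l))"
      by (rule prod_power_delta_add[OF that(2)])
    also have "(\<Prod>l<N. x l ^ (a j * t l)) = (\<Prod>l<N. x l ^ t l) ^ a j"
      by (simp add: prod_power_distrib mult.commute flip: power_mult)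
    finally show ?thesis by (simp add: mult.commute)
  qed
  have yq: "y (q w) i = (\<Prod>l<N. Y w l ^ u l) * Y w i" if "i < N" for w i
  proof -
    have "y (q w) i = (\<Prod>j<N. (\<Prod>l<N. Y w l ^ E j l) ^ b i j)"
      by (simp add: y_def q_def)
    also have "\<dots> = (\<Prod>l<N. Y w l ^ ((if i = l then 1 else 0) + u l))"
      unfolding monomial_map_compose using BE[OF that] by (intro prod.cong) auto
    also have "\<dots> = Y w i * (\<Prod>l<N. Y w l ^ u l)"
      by (rule prod_power_delta_add[OF that])
    finally show ?thesis by (simp add: mult.commute)
  qed
  have f_q: "eval_mvpoly f (q w) = 0" for w
  proof -
    have "eval_mvpoly f (q w) = (\<Sum>i<N. to_ac (K i) * y (q w) i)"
      by (simp add: f y_def)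
    also have "\<dots> = (\<Prod>l<N. Y w l ^ u l) * (\<Sum>i<N. to_ac (K i) * Y w i)"
      using yq by (simp add: sum_distrib_left mult.left_commute)
    finally show ?thesis
      using Y_hyperplane by simp
  qed
  have U_sub: "U \<subseteq> wproj N a" and V_sub: "V \<subseteq> wproj (n + 1) ?one"
    by (auto simp: U_def V_def nonvanishing_def)
  have U_iff: "P \<in> U \<longleftrightarrow> eval_mvpoly f x = 0 \<and> (\<forall>j<N. x j \<noteq> 0)" if "P \<in> wproj N a" "x \<in> P" for P x
  proof -
    have "P \<in> nonvanishing N a G \<longleftrightarrow> (\<forall>j<N. x j \<noteq> 0)"
      using nonvanishing_iff[OF G that] by (auto simp: G_def)
    moreover have "P \<in> Z \<longleftrightarrow> eval_mvpoly f x = 0"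
      unfolding Z_def hypersurface_def
      using that weighted_form_zero_iff[OF weighted_form_eval[OF hom] that] by blast
    ultimately show ?thesis
      unfolding U_def by blast
  qed
  have V_iff: "Q \<in> V \<longleftrightarrow> (\<forall>i<N. Y w i \<noteq> 0)" if "Q \<in> wproj (n + 1) ?one" "w \<in> Q" for Q w
    using nonvanishing_iff[OF H that] by (auto simp: V_def H_def)
  have p_torus: "p x \<in> nonzero_vectors (n + 1)" "\<forall>i<N. Y (p x) i \<noteq> 0"
    if "eval_mvpoly f x = 0" "\<forall>j<N. x j \<noteq> 0" for x
  proof -
    have "y x i \<noteq> 0" for i
      using that(2) by (simp add: y_def)
    then show "p x \<in> nonzero_vectors (n + 1)" "\<forall>i<N. Y (p x) i \<noteq> 0"
      using Yp[OF that(1)] by (auto simp: nonzero_vectors_def p_def)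
  qed
  have q_torus: "q w \<in> nonzero_vectors N" "\<forall>j<N. q w j \<noteq> 0" if "\<forall>i<N. Y w i \<noteq> 0" for w
  proof -
    show "\<forall>j<N. q w j \<noteq> 0"
      using that by (simp add: q_def)
    then show "q w \<in> nonzero_vectors N"
      by (auto simp: nonzero_vectors_def q_def N)
  qed
  define \<phi> where "\<phi> = induced_map (n + 1) ?one p"
  define \<psi> where "\<psi> = induced_map N a q"
  have p_nz: "p x \<in> nonzero_vectors (n + 1)" if "P \<in> U" "x \<in> P" for P x
    using that U_iff[of P x] U_sub p_torus by blast
  have q_nz: "q w \<in> nonzero_vectors N" if "Q \<in> V" "w \<in> Q" for Q w
    using that V_iff[of Q w] V_sub q_torus by blast
  have \<phi>: "\<phi> P \<in> V" "p x \<in> \<phi> P" if "P \<in> U" "x \<in> P" for P x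
  proof -
    have P: "P \<in> wproj N a"
      using that U_sub by blast
    from induced_map_class[where M = "n + 1" and b = ?one and p = p, OF p p_nz[OF that(1)] P that(2)]
    have *: "\<phi> P \<in> wproj (n + 1) ?one" "p x \<in> \<phi> P"
      by (simp_all add: \<phi>_def)
    show "p x \<in> \<phi> P" by fact
    show "\<phi> P \<in> V"
      using V_iff[OF *] U_iff[OF P that(2)] that p_torus by blast
  qed
  have \<psi>: "\<psi> Q \<in> U" "q w \<in> \<psi> Q" if "Q \<in> V" "w \<in> Q" for Q w
  proof -
    have Q: "Q \<in> wproj (n + 1) ?one"
      using that V_sub by blast
    from induced_map_class[where M = N and b = a and p = q, OF q q_nz[OF that(1)] Q that(2)]
    have *: "\<psi> Q \<in> wproj N a" "q w \<in> \<psi> Q"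
      by (simp_all add: \<psi>_def)
    show "q w \<in> \<psi> Q" by fact
    show "\<psi> Q \<in> U"
      using U_iff[OF *] V_iff[OF Q that(2)] that q_torus f_q by blast
  qed
  have \<phi>U: "\<phi> P \<in> V" if "P \<in> U" for P
    using \<phi>(1)[OF that] wproj_nonempty that U_sub by blast
  have \<psi>V: "\<psi> Q \<in> U" if "Q \<in> V" for Q
    using \<psi>(1)[OF that] wproj_nonempty that V_sub by blast
  have inv1: "\<psi> (\<phi> P) = P" if P: "P \<in> U" for P
  proof -
    obtain x where x: "x \<in> P"
      using wproj_nonempty P U_sub by blast
    have P': "P \<in> wproj N a"
      using P U_sub by blast
    have fx: "eval_mvpoly f x = 0" "\<forall>j<N. x j \<noteq> 0"
      using U_iff[OF P' x] P by auto
    have xnz: "x \<in> nonzero_vectors N"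
      using wproj_mem_nonzero P' x by blast
    have qx: "q (p x) \<in> \<psi> (\<phi> P)"
      using \<psi>(2)[OF \<phi>[OF P x]] .
    have qnz: "q (p x) \<in> nonzero_vectors N"
      using q_nz[OF \<phi>[OF P x]] .
    have "q (p x) j = (\<Prod>l<N. x l ^ t l) ^ a j * x j" for j
    proof (cases "j < N")
      case False
      then show ?thesis using xnz qnz by (simp add: nonzero_vectors_def)
    qed (use qp fx in auto)
    moreover have "(\<Prod>l<N. x l ^ t l) \<noteq> 0"
      using fx(2) by simp
    ultimately have "(x, q (p x)) \<in> weighted_rel N a"
      using xnz qnz unfolding weighted_rel_def by blast
    then show ?thesis
      using wproj_eqI[OF P' _ x qx] \<psi>V[OF \<phi>U[OF P]] U_sub by blast
  qed
  have inv2: "\<phi> (\<psi> Q) = Q" if Q: "Q \<in> V" for Q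
  proof -
    obtain w where w: "w \<in> Q"
      using wproj_nonempty Q V_sub by blast
    have Q': "Q \<in> wproj (n + 1) ?one"
      using Q V_sub by blast
    have Yw: "\<forall>i<N. Y w i \<noteq> 0"
      using V_iff[OF Q' w] Q by auto
    have wnz: "w \<in> nonzero_vectors (n + 1)"
      using wproj_mem_nonzero Q' w by blast
    have pw: "p (q w) \<in> \<phi> (\<psi> Q)"
      using \<phi>(2)[OF \<psi>[OF Q w]] .
    have pnz: "p (q w) \<in> nonzero_vectors (n + 1)"
      using p_nz[OF \<psi>[OF Q w]] .
    have "p (q w) i = (\<Prod>l<N. Y w l ^ u l) ^ ?one i * w i" for i
    proof (cases "i < n + 1")
      case True
      then show ?thesis using yq[of i w] by (simp add: p_def Y_def N)
    next
      case False
      then show ?thesis using wnz pnz by (simp add: nonzero_vectors_def)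
    qed
    moreover have "(\<Prod>l<N. Y w l ^ u l) \<noteq> 0"
      using Yw by simp
    ultimately have "(w, p (q w)) \<in> weighted_rel (n + 1) ?one"
      using wnz pnz unfolding weighted_rel_def by blast
    then show ?thesis
      using wproj_eqI[OF Q' _ w pw] \<phi>U[OF \<psi>V[OF Q]] V_sub by blast
  qed
  have "V \<noteq> {}"
  proof -
    define S where "S = (\<Sum>i<n. to_ac (K i))"
    have kn: "to_ac (K n) \<noteq> 0"
      using K[of n] by (simp add: N)
    obtain c where c: "c \<noteq> 0" "c \<noteq> - S / to_ac (K n)"
      using alg_closed_avoids by blast
    define w where "w i = (if i < n then 1 else if i = n then c else 0)" for i
    have w: "w \<in> nonzero_vectors (n + 1)"
      using c by (auto simp: nonzero_vectors_def w_def)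
    have Lw: "L w = S + c * to_ac (K n)"
      by (simp add: L_def w_def S_def mult.commute)
    have "L w \<noteq> 0"
    proof
      assume "L w = 0"
      then have "c * to_ac (K n) = - S"
        unfolding Lw by (simp add: eq_neg_iff_add_eq_0 add.commute)
      then show False
        using c(2) nonzero_eq_divide_eq[OF kn, of c "- S"] by blast
    qed
    moreover have "to_ac (- 1 / K (n + 1)) \<noteq> 0"
      using Kn by simp
    ultimately have "\<forall>i<N. Y w i \<noteq> 0"
      using c(1) by (simp add: Y_def w_def)
    then have "weighted_rel (n + 1) ?one `` {w} \<in> V"
      using V_iff[OF wproj_class[OF w] wproj_class_mem[OF w]] by simp
    then show ?thesis
      by blast
  qed
  then have "U \<noteq> {}"
    using \<psi>V by blast
  have "morphism_on N a U (n + 1) ?one V \<phi>"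
    unfolding \<phi>_def
    by (rule morphism_on_induced_map[OF p U_sub V_sub p_nz \<phi>U[unfolded \<phi>_def]])
  moreover have "morphism_on (n + 1) ?one V N a U \<psi>"
    unfolding \<psi>_def
    by (rule morphism_on_induced_map[OF q V_sub U_sub q_nz \<psi>V[unfolded \<psi>_def]])
  moreover have "openin (subtopology (zariski N a) Z) U"
    unfolding U_def by (rule openin_subtopology_Int2[OF openin_nonvanishing[OF G]])
  moreover have "openin (subtopology (zariski (n + 1) ?one) (wproj (n + 1) ?one)) V"
    using openin_subtopology_Int[OF openin_nonvanishing[OF H], of "wproj (n + 1) ?one"] V_sub
    by (simp add: V_def Int_absorb2)
  ultimately have "birational_map N a Z (n + 1) ?one (wproj (n + 1) ?one) U V \<phi>"
    unfolding birational_map_def using \<open>U \<noteq> {}\<close> \<open>V \<noteq> {}\<close> inv1 inv2 by blast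
  then show ?thesis
    unfolding rational_variety_def Z_def N_def by blast
qed

theorem theorem3p2:
  fixes n d :: nat
    and a :: "nat \<Rightarrow> nat"
    and B :: "nat mat"
    and f :: "'a::field mvpoly"
  assumes "well_formed (n + 2) a"
    and "invertible_delsarte (n + 2) B f"
    and "weighted_homogeneous (n + 2) a d f"
    and "irreducible_space (subtopology (zariski (n + 2) a) (hypersurface (n + 2) a f))"
    and "of_nat d = \<bar>det (map_mat of_nat B :: rat mat)\<bar>"
  shows "rational_variety (n + 2) a (hypersurface (n + 2) a f) n"
proof -
  define b where "b i j = B $$ (i, j)" for i j
  have f: "delsarte (n + 2) B f" and inv: "invertible_mat (map_mat of_nat B :: rat mat)"
    using assms(2) by (auto simp: invertible_delsarte_def)
  then have B: "B \<in> carrier_mat (n + 2) (n + 2)"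
    by (simp add: delsarte_def)
  obtain K where K: "\<And>i. i < n + 2 \<Longrightarrow> K i \<noteq> 0"
    and fK: "\<And>x. eval_mvpoly f x = (\<Sum>i<n+2. to_ac (K i) * (\<Prod>j<n+2. x j ^ b i j))"
    and weights: "\<And>a d i. weighted_homogeneous (n + 2) a d f \<Longrightarrow> i < n + 2 \<Longrightarrow> (\<Sum>j<n+2. b i j * a j) = d"
    unfolding b_def using delsarte_expand[OF f] by blast
  note weight = weights[OF assms(3)]
  let ?B = "mat (n + 2) (n + 2) (\<lambda>(i, j). int (b i j))"
  have detB: "det (map_mat of_nat B :: rat mat) = of_int (det ?B)"
    using det_map_of_nat[OF B] by (simp add: b_def)
  have "det ?B \<noteq> 0"
    using det_nonzero_if_invertible[OF _ inv, of "n + 2"] B detB by simp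
  have "rat_of_int (int d) = of_int \<bar>det ?B\<bar>"
    using assms(5) detB by simp
  then have det: "\<bar>det ?B\<bar> = int d"
    by (simp only: of_int_eq_iff)
  then have "d > 0"
    using \<open>det ?B \<noteq> 0\<close> by simp
  have pos: "\<And>j. j < n + 2 \<Longrightarrow> a j > 0" and "Gcd (a ` ({..<n + 2} - {0})) = 1"
    using assms(1) by (auto simp: well_formed_def)
  moreover have "Gcd (a ` {..<n + 2}) dvd Gcd (a ` ({..<n + 2} - {0}))"
    by (rule Gcd_greatest) (auto intro: Gcd_dvd)
  ultimately have gcd: "Gcd (a ` {..<n + 2}) = 1"
    by simp
  obtain E t where EB: "\<And>j l. j < n + 2 \<Longrightarrow> l < n + 2 \<Longrightarrow>
      (\<Sum>i<n+2. E j i * b i l) = (if j = l then 1 else 0) + a j * t l"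
    using exponent_inverse[OF _ pos gcd weight det \<open>d > 0\<close>] by auto
  obtain D where D: "\<And>j. j < n + 2 \<Longrightarrow> (\<Sum>i<n+2. E j i) = D * a j"
    using exponent_inverse_degree[OF gcd \<open>d > 0\<close> weight EB] by blast
  obtain u where BE: "\<And>i l. i < n + 2 \<Longrightarrow> l < n + 2 \<Longrightarrow>
      (\<Sum>j<n+2. b i j * E j l) = (if i = l then 1 else 0) + u l"
    using exponent_inverse_right[OF _ \<open>det ?B \<noteq> 0\<close> weight EB] by auto
  show ?thesis
    by (rule rational_if_exponents_invertible[OF assms(3) K fK weight EB BE D])
qed

end
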